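(* Assume that all of the following hold. (1) There exists $\gamma>0$ such that $p(n)=O(n^\gamma)$ as $n\to\infty$. (2) For all $n\in\mathbb{N}$ and $a\in\Gamma(n)$, $\mathrm{Var}(X_a)=1$; and there exists $v^2>0$ such that $\mathrm{Var}(X_a\mid X_{\Gamma(n)\setminus\{a\}})\ge v^2$ for all $n\in\mathbb{N}$ and $a\in\Gamma(n)$. (3) There exists $0\le\kappa<1$ such that $\max_{a\in\Gamma(n)}|\mathrm{ne}_a|=O(n^\kappa)$ as $n\to\infty$. (4) There exists $\vartheta<\infty$ such that for all $n\in\mathbb{N}$ and all neighboring nodes $a,b\in\Gamma(n)$, $\|\theta^{a,\mathrm{ne}_b\setminus\{a\}}\|_1\le\vartheta$. (5) There exist $\delta>0$ and $\xi>\kappa$ (with $\kappa$ as in (3)) such that for all $n\in\mathbb{N}$ and every $(a,b)\in E$, $|\pi_{ab}|\ge\delta n^{-(1-\xi)/2}$. (6) There exists $\delta'<1$ such that for all $n\in\mathbb{N}$ and all $a,b\in\Gamma(n)$ with $b\ne a$ and $b\notin\mathrm{ne}_a$, $|S_a(b)|<\delta'$. Let $0<\alpha<1$ and, when estimating the neighborhood of node $a$, use the penalty parameter $$\lambda=\lambda(\alpha)=\frac{2\hat\sigma_a}{\sqrt n}\,\tilde\Phi^{-1}\!\left(\frac{\alpha}{2p(n)^2}\right),\qquad \hat\sigma_a^2=n^{-1}\langle\mathbf{X}_a,\mathbf{X}_a\rangle,\qquad \tilde\Phi=1-\Phi,$$ where $\Phi$ is the distribution function of $\mathcal{N}(0,1)$.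 Then for all $n\in\mathbb{N}$, $$P(\exists\,a\in\Gamma(n):\hat C_a^{\lambda}\nsubseteq C_a)\le\alpha .$$
   Context: For each $n\in\mathbb{N}$ let $\Gamma(n)=\{1,\dots,p(n)\}$ be a finite set of nodes and let $X=(X_k)_{k\in\Gamma(n)}\sim\mathcal{N}(0,\Sigma(n))$ with $\Sigma(n)$ nonsingular; write $K=\Sigma^{-1}(n)$. The dependence on $n$ of the objects below is suppressed. $\mathbf{X}$ is the $n\times p(n)$ random matrix whose rows are $n$ independent observations of $X$; $\mathbf{X}_a\in\mathbb{R}^n$ is its column for node $a$; $\langle\cdot,\cdot\rangle$ and $\|\cdot\|_2$ are the usual inner product and norm on $\mathbb{R}^n$, and $\|\theta\|_1=\sum_{b\in\Gamma(n)}|\theta_b|$. Graph: the edge set $E\subseteq\Gamma(n)\times\Gamma(n)$ consists of the pairs $(a,b)$, $a\ne b$, such that $X_a$ and $X_b$ are conditionally dependent given all remaining variables (equivalently $K_{ab}\neq0$). The neighborhood of $a$ is $\mathrm{ne}_a=\{b\in\Gamma(n)\setminus\{a\}:(a,b)\in E\}$; $a,b$ are neighboring if $b\in\mathrm{ne}_a$. The partial correlation is $\pi_{ab}=-K_{ab}/\sqrt{K_{aa}K_{bb}}$, the correlation of $X_a$ and $X_b$ after eliminating the linear effects of all remaining variables. Optimal prediction: for $\mathcal{A}\subseteq\Gamma(n)\setminus\{a\}$, $\theta^{a,\mathcal{A}}=\arg\min\{E(X_a-\sum_{k\in\Gamma(n)}\theta_kX_k)^2:\theta\in\mathbb{R}^{p(n)},\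 \theta_k=0\ \forall k\notin\mathcal{A}\}$. For $a,b\in\Gamma(n)$ with $b\notin\mathrm{ne}_a\cup\{a\}$, $S_a(b)=\sum_{k\in\mathrm{ne}_a}\mathrm{sign}(\theta_k^{a,\mathrm{ne}_a})\,\theta_k^{b,\mathrm{ne}_a}$. Lasso: $\hat\theta^{a,\lambda}$ is any minimizer of $n^{-1}\|\mathbf{X}_a-\mathbf{X}\theta\|_2^2+\lambda\|\theta\|_1$ over $\theta\in\mathbb{R}^{p(n)}$ with $\theta_a=0$, and $\hat{\mathrm{ne}}_a^{\lambda}=\{b\in\Gamma(n):\hat\theta_b^{a,\lambda}\ne0\}$. The estimated edge set $\hat E^{\lambda}$ is either one of $\hat E^{\lambda,\wedge}=\{(a,b):a\in\hat{\mathrm{ne}}_b^{\lambda}\text{ and }b\in\hat{\mathrm{ne}}_a^{\lambda}\}$ or $\hat E^{\lambda,\vee}=\{(a,b):a\in\hat{\mathrm{ne}}_b^{\lambda}\text{ or }b\in\hat{\mathrm{ne}}_a^{\lambda}\}$ (the result holds for both), where each $\hat{\mathrm{ne}}_a^{\lambda}$ is computed with the node-specific penalty $\lambda(\alpha)$ based on $\hat\sigma_a$. Connectivity components: $C_a\subseteq\Gamma(n)$ is the connected component of $a$ in the graph $(\Gamma(n),E)$, i.e. the set of nodes connected to $a$ by a chain of edges (including $a$); $\hat C_a^{\lambda}$ is the connected component of $a$ in the graph $(\Gamma(n),\hat E^{\lambda})$. *)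

theory Defs
  imports
    "HOL-Probability.Probability"
    "HOL-Library.Landau_Symbols"
    "Jordan_Normal_Form.Gauss_Jordan_Elimination"
    "Jordan_Normal_Form.Determinant"
begin

(* Matrices are indexed from 0, so the node set of size p is {..<p}. A coefficient vector in R^p
   is a function nat => real that vanishes outside {..<p}. *)

definition quad_form :: "nat \<Rightarrow> real mat \<Rightarrow> (nat \<Rightarrow> real) \<Rightarrow> real" where
  "quad_form p A x = (\<Sum>i<p. \<Sum>j<p. x i * A $$ (i, j) * x j)"

definition covariance_matrix :: "nat \<Rightarrow> real mat \<Rightarrow> bool" where
  "covariance_matrix p S \<longleftrightarrow>
     S \<in> carrier_mat p p \<and>
     (\<forall>i<p. \<forall>j<p. S $$ (i, j) = S $$ (j, i)) \<and>
     (\<forall>x. 0 \<le> quad_form p S x)"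

definition precision :: "real mat \<Rightarrow> real mat" where
  "precision S = the (mat_inverse S)"

definition mvn_density :: "nat \<Rightarrow> real mat \<Rightarrow> (nat \<Rightarrow> real) \<Rightarrow> real" where
  "mvn_density p S x =
     exp (- quad_form p (precision S) x / 2) / sqrt ((2 * pi) ^ p * Determinant.det S)"

definition random_vector :: "nat set \<Rightarrow> (nat \<Rightarrow> 'a \<Rightarrow> real) \<Rightarrow> 'a \<Rightarrow> nat \<Rightarrow> real" where
  "random_vector B X \<omega> = (\<lambda>k\<in>B. X k \<omega>)"

(* X has law N(0, S), S nonsingular, expressed through its Lebesgue density on R^p. *)
definition centered_normal ::
    "'a measure \<Rightarrow> nat \<Rightarrow> real mat \<Rightarrow> (nat \<Rightarrow> 'a \<Rightarrow> real) \<Rightarrow> bool" where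
  "centered_normal M p S X \<longleftrightarrow>
     covariance_matrix p S \<and> invertible_mat S \<and>
     distributed M (\<Pi>\<^sub>M i\<in>{..<p}. lborel) (random_vector {..<p} X)
       (\<lambda>x. ennreal (mvn_density p S x))"

definition generated_by ::
    "'a measure \<Rightarrow> (nat \<Rightarrow> 'a \<Rightarrow> real) \<Rightarrow> nat set \<Rightarrow> 'a measure" where
  "generated_by M X B =
     vimage_algebra (space M) (random_vector B X) (\<Pi>\<^sub>M i\<in>B. borel)"

definition cond_variance :: "'a measure \<Rightarrow> 'a measure \<Rightarrow> ('a \<Rightarrow> real) \<Rightarrow> 'a \<Rightarrow> real" where
  "cond_variance M F Y =
     real_cond_exp M F (\<lambda>\<omega>. (Y \<omega> - real_cond_exp M F Y \<omega>)\<^sup>2)"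

definition cond_prob_given :: "'a measure \<Rightarrow> 'a measure \<Rightarrow> 'a set \<Rightarrow> 'a \<Rightarrow> real" where
  "cond_prob_given M F A = real_cond_exp M F (indicator A)"

definition cond_indep ::
    "'a measure \<Rightarrow> 'a measure \<Rightarrow> ('a \<Rightarrow> real) \<Rightarrow> ('a \<Rightarrow> real) \<Rightarrow> bool" where
  "cond_indep M F Y Z \<longleftrightarrow>
     (\<forall>A\<in>sets borel. \<forall>B\<in>sets borel. AE \<omega> in M.
        cond_prob_given M F {\<omega>\<in>space M. Y \<omega> \<in> A \<and> Z \<omega> \<in> B} \<omega> =
        cond_prob_given M F {\<omega>\<in>space M. Y \<omega> \<in> A} \<omega> * cond_prob_given M F {\<omega>\<in>space M. Z \<omega> \<in> B} \<omega>)"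

definition edges :: "'a measure \<Rightarrow> nat \<Rightarrow> (nat \<Rightarrow> 'a \<Rightarrow> real) \<Rightarrow> (nat \<times> nat) set" where
  "edges M p X = {(a, b). a < p \<and> b < p \<and> a \<noteq> b \<and>
     \<not> cond_indep M (generated_by M X ({..<p} - {a, b})) (X a) (X b)}"

definition neighborhood :: "'a measure \<Rightarrow> nat \<Rightarrow> (nat \<Rightarrow> 'a \<Rightarrow> real) \<Rightarrow> nat \<Rightarrow> nat set" where
  "neighborhood M p X a = {b. b < p \<and> b \<noteq> a \<and> (a, b) \<in> edges M p X}"

definition partial_corr :: "real mat \<Rightarrow> nat \<Rightarrow> nat \<Rightarrow> real" where
  "partial_corr S a b =
     - (precision S $$ (a, b)) / sqrt (precision S $$ (a, a) * precision S $$ (b, b))"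

definition l1_norm :: "nat \<Rightarrow> (nat \<Rightarrow> real) \<Rightarrow> real" where
  "l1_norm p \<theta> = (\<Sum>k<p. \<bar>\<theta> k\<bar>)"

definition opt_coeff ::
    "'a measure \<Rightarrow> nat \<Rightarrow> (nat \<Rightarrow> 'a \<Rightarrow> real) \<Rightarrow> nat \<Rightarrow> nat set \<Rightarrow> nat \<Rightarrow> real" where
  "opt_coeff M p X a A =
     arg_min (\<lambda>\<theta>. LINT \<omega>|M. (X a \<omega> - (\<Sum>k<p. \<theta> k * X k \<omega>))\<^sup>2) (\<lambda>\<theta>. \<forall>k. k \<notin> A \<longrightarrow> \<theta> k = 0)"

definition nbhd_stability ::
    "'a measure \<Rightarrow> nat \<Rightarrow> (nat \<Rightarrow> 'a \<Rightarrow> real) \<Rightarrow> nat \<Rightarrow> nat \<Rightarrow> real" where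
  "nbhd_stability M p X a b =
     (\<Sum>k\<in>neighborhood M p X a.
        sgn (opt_coeff M p X a (neighborhood M p X a) k) *
        opt_coeff M p X b (neighborhood M p X a) k)"

(* In the following, D i k is the k-th coordinate of the i-th of n observations. *)

definition lasso_objective ::
    "nat \<Rightarrow> nat \<Rightarrow> (nat \<Rightarrow> nat \<Rightarrow> real) \<Rightarrow> nat \<Rightarrow> real \<Rightarrow> (nat \<Rightarrow> real) \<Rightarrow> real" where
  "lasso_objective n p D a l \<theta> =
     (\<Sum>i<n. (D i a - (\<Sum>k<p. D i k * \<theta> k))\<^sup>2) / real n + l * l1_norm p \<theta>"

definition is_lasso ::
    "nat \<Rightarrow> nat \<Rightarrow> (nat \<Rightarrow> nat \<Rightarrow> real) \<Rightarrow> nat \<Rightarrow> real \<Rightarrow> (nat \<Rightarrow> real) \<Rightarrow> bool" where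
  "is_lasso n p D a l =
     is_arg_min (lasso_objective n p D a l) (\<lambda>\<theta>. \<theta> a = 0 \<and> (\<forall>k\<ge>p. \<theta> k = 0))"

definition normal_tail :: "real \<Rightarrow> real" where
  "normal_tail z = 1 - cdf std_normal_distribution z"

definition sigma_hat :: "nat \<Rightarrow> (nat \<Rightarrow> nat \<Rightarrow> real) \<Rightarrow> nat \<Rightarrow> real" where
  "sigma_hat n D a = sqrt ((\<Sum>i<n. (D i a)\<^sup>2) / real n)"

definition penalty :: "nat \<Rightarrow> nat \<Rightarrow> (nat \<Rightarrow> nat \<Rightarrow> real) \<Rightarrow> real \<Rightarrow> nat \<Rightarrow> real" where
  "penalty n p D \<alpha> a =
     2 * sigma_hat n D a / sqrt (real n) * the_inv normal_tail (\<alpha> / (2 * (real p)\<^sup>2))"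

(* T a is the estimated coefficient vector for node a; the two edge set estimates are obtained
   for R the conjunction and the disjunction. *)
definition est_edges ::
    "(bool \<Rightarrow> bool \<Rightarrow> bool) \<Rightarrow> nat \<Rightarrow> (nat \<Rightarrow> nat \<Rightarrow> real) \<Rightarrow> (nat \<times> nat) set" where
  "est_edges R p T = {(a, b). a < p \<and> b < p \<and> R (T b a \<noteq> 0) (T a b \<noteq> 0)}"

definition component :: "(nat \<times> nat) set \<Rightarrow> nat \<Rightarrow> nat set" where
  "component E a = E\<^sup>* `` {a}"

end

theory Submission
  imports Defs
begin

text \<open>
An estimated component can leave the true one only if some node \<open>a\<close> selects a node outside its
component \<open>C\<close>. To exclude this, compare the lasso for \<open>a\<close> over all nodes with the lasso restricted to
\<open>C\<close>, and let \<open>r\<close> be the residual of the latter. If \<open>\<bar>2 * \<langle>r, X\<^sub>b\<rangle> / n\<bar> < \<lambda>\<close> for every \<open>b\<close> outside \<open>C\<close>, then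
every solution of the full problem vanishes outside \<open>C\<close> (\<open>lasso_no_spurious_coefficients\<close>). Both \<open>r\<close> and
\<open>\<lambda>\<close> depend only on the observations of nodes in \<open>C\<close>, and the observations of \<open>b\<close> are independent of
these. Given the former, \<open>\<langle>r, X\<^sub>b\<rangle>\<close> is thus centred normal with standard deviation \<open>\<parallel>r\<parallel>\<close>, and
\<open>\<parallel>r\<parallel> \<le> \<parallel>X\<^sub>a\<parallel>\<close> because the zero vector competes in the restricted problem. As \<open>n * \<lambda> / 2\<close> equals
\<open>\<parallel>X\<^sub>a\<parallel>\<close> times the normal quantile of level \<open>1 - \<alpha> / (2 * p\<^sup>2)\<close>, the bound fails with probability at most
\<open>\<alpha> / p\<^sup>2\<close> (\<open>false_edge_event\<close>). Summing over at most \<open>p\<^sup>2\<close> pairs gives \<open>\<alpha>\<close>.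

Two points lie below this argument. First, edges are defined by conditional dependence, so independence
across components has to be extracted from conditional independence given all other variables. That
condition forces the coefficient of \<open>x\<^sub>a * x\<^sub>b\<close> in the exponent of the density to vanish
(\<open>cond_indep_imp_no_cross_term\<close>): a nonzero coefficient makes the signs of the two variables dependent in
every slice. Hence the density factorises over \<open>C\<close> and its complement (\<open>gaussian_blocks_prob\<close>).

Second, the lasso solution is an arbitrary minimiser and may depend on the sample point in a nonmeasurable
way. The residual, however, is unique by strict convexity in the fitted values, and it is a limit of
measurable functions (\<open>measurable_lasso_residual\<close>). The event in question, measurable or not, is
contained in a measurable set of probability at most \<open>\<alpha>\<close>.
\<close>

section \<open>The lasso restricted to a set of predictors\<close>

text \<open>Coefficients outside \<open>K\<close> are ignored instead of being constrained to vanish. Minimisation is then over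
all functions, and objectives for different sets of predictors can be compared directly.\<close>

definition lasso_obj ::
    "nat \<Rightarrow> nat set \<Rightarrow> (nat \<Rightarrow> nat \<Rightarrow> real) \<Rightarrow> nat \<Rightarrow> real \<Rightarrow> (nat \<Rightarrow> real) \<Rightarrow> real" where
  "lasso_obj n K D a l \<theta> =
     (\<Sum>i<n. (D i a - (\<Sum>k\<in>K. D i k * \<theta> k))\<^sup>2) / real n + l * (\<Sum>k\<in>K. \<bar>\<theta> k\<bar>)"

definition lasso_min ::
    "nat \<Rightarrow> nat set \<Rightarrow> (nat \<Rightarrow> nat \<Rightarrow> real) \<Rightarrow> nat \<Rightarrow> real \<Rightarrow> (nat \<Rightarrow> real) \<Rightarrow> bool" where
  "lasso_min n K D a l \<phi> \<longleftrightarrow> (\<forall>\<psi>. lasso_obj n K D a l \<phi> \<le> lasso_obj n K D a l \<psi>)"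

lemma nonneg_of_small_perturbation:
  fixes x y :: real
  assumes "\<And>t. 0 < t \<Longrightarrow> t \<le> 1 \<Longrightarrow> 0 \<le> x * t + y * t\<^sup>2"
  shows "0 \<le> x"
proof (rule ccontr)
  assume "\<not> 0 \<le> x"
  then have x: "x < 0" by simp
  define t where "t = min 1 (- x / (2 * (\<bar>y\<bar> + 1)))"
  have t: "0 < t" "t \<le> 1" using x by (auto simp: t_def divide_neg_pos)
  have "t * (2 * (\<bar>y\<bar> + 1)) \<le> - x"
    using x by (simp add: t_def min_def divide_simps split: if_splits)
  then have "2 * t + 2 * (\<bar>y\<bar> * t) \<le> - x" by (simp add: algebra_simps)
  moreover have "y * t \<le> \<bar>y\<bar> * t" using t by (intro mult_right_mono) auto
  ultimately have "x + y * t < 0" using t x by linarith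
  then have "(x + y * t) * t < 0" using t by (simp add: mult_neg_pos)
  then show False using assms[OF t] by (simp add: algebra_simps power2_eq_square)
qed

text \<open>The subgradient condition in a form that needs no subgradients: moving from the minimiser
\<open>\<phi>\<close> towards \<open>\<psi>\<close> by a fraction \<open>t\<close> changes the quadratic part by a multiple of \<open>t\<close> and a multiple of
\<open>t\<^sup>2\<close>, and the penalty, by convexity, by at most a multiple of \<open>t\<close>. The coefficient of \<open>t\<close> in the total must
therefore be nonnegative.\<close>

lemma lasso_variational_inequality:
  assumes min: "lasso_min n K D a l \<phi>" and l: "0 \<le> l"
  defines "r \<equiv> \<lambda>i. D i a - (\<Sum>k\<in>K. D i k * \<phi> k)"
  shows "2 * (\<Sum>i<n. r i * (\<Sum>k\<in>K. D i k * (\<psi> k - \<phi> k))) / real n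
           \<le> l * (\<Sum>k\<in>K. \<bar>\<psi> k\<bar>) - l * (\<Sum>k\<in>K. \<bar>\<phi> k\<bar>)"
proof -
  define w where "w = (\<lambda>i. \<Sum>k\<in>K. D i k * (\<psi> k - \<phi> k))"
  define N where "N = (\<lambda>\<theta>::nat\<Rightarrow>real. \<Sum>k\<in>K. \<bar>\<theta> k\<bar>)"
  have "0 \<le> (l * N \<psi> - l * N \<phi> - 2 * (\<Sum>i<n. r i * w i) / real n) * t
              + ((\<Sum>i<n. (w i)\<^sup>2) / real n) * t\<^sup>2" if t: "0 < t" "t \<le> 1" for t
  proof -
    define \<eta> where "\<eta> = (\<lambda>k. (1 - t) * \<phi> k + t * \<psi> k)"
    have res: "D i a - (\<Sum>k\<in>K. D i k * \<eta> k) = r i - t * w i" for i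
    proof -
      have "(\<Sum>k\<in>K. D i k * \<eta> k) = (\<Sum>k\<in>K. D i k * \<phi> k + t * (D i k * (\<psi> k - \<phi> k)))"
        by (rule sum.cong) (auto simp: \<eta>_def algebra_simps)
      then show ?thesis by (simp add: r_def w_def sum.distrib sum_distrib_left)
    qed
    have "N \<eta> \<le> (\<Sum>k\<in>K. (1 - t) * \<bar>\<phi> k\<bar> + t * \<bar>\<psi> k\<bar>)"
      unfolding N_def
    proof (rule sum_mono)
      fix k show "\<bar>\<eta> k\<bar> \<le> (1 - t) * \<bar>\<phi> k\<bar> + t * \<bar>\<psi> k\<bar>"
        using t abs_triangle_ineq[of "(1 - t) * \<phi> k" "t * \<psi> k"] by (simp add: \<eta>_def abs_mult)
    qed
    then have "N \<eta> \<le> (1 - t) * N \<phi> + t * N \<psi>" by (simp add: N_def sum.distrib sum_distrib_left)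
    then have "l * N \<eta> \<le> l * ((1 - t) * N \<phi> + t * N \<psi>)" using l by (rule mult_left_mono)
    moreover have "(\<Sum>i<n. (r i)\<^sup>2) / real n + l * N \<phi> \<le> (\<Sum>i<n. (r i - t * w i)\<^sup>2) / real n + l * N \<eta>"
      using min[unfolded lasso_min_def, rule_format, of \<eta>]
      unfolding lasso_obj_def res by (simp add: r_def N_def)
    moreover have "(\<Sum>i<n. (r i - t * w i)\<^sup>2)
        = (\<Sum>i<n. (r i)\<^sup>2) - 2 * t * (\<Sum>i<n. r i * w i) + t\<^sup>2 * (\<Sum>i<n. (w i)\<^sup>2)"
      by (simp add: power2_diff sum.distrib sum_subtractf sum_distrib_left algebra_simps)
    ultimately show ?thesis by (simp add: algebra_simps add_divide_distrib diff_divide_distrib)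
  qed
  from nonneg_of_small_perturbation[OF this] show ?thesis by (simp add: w_def N_def)
qed

text \<open>Expand the square around the residual \<open>r\<close> of the minimiser over \<open>K\<close>. The linear terms inside \<open>K\<close> are
absorbed by the variational inequality; what remains is a square and one term for each further
predictor. With \<open>K = G\<close> this is strong convexity in the fitted values, which makes the residual unique.
With \<open>K\<close> smaller it tells which of the further predictors can be worth their penalty.\<close>

lemma lasso_excess:
  assumes fin: "finite G" and KG: "K \<subseteq> G" and min: "lasso_min n K D a l \<phi>" and l: "0 \<le> l"
  defines "r \<equiv> \<lambda>i. D i a - (\<Sum>k\<in>K. D i k * \<phi> k)"
  shows "lasso_obj n K D a l \<phi>
           + (\<Sum>i<n. (D i a - (\<Sum>k\<in>G. D i k * \<theta> k) - r i)\<^sup>2) / real n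
           + (\<Sum>b\<in>G - K. l * \<bar>\<theta> b\<bar> - 2 * (\<Sum>i<n. r i * D i b) / real n * \<theta> b)
         \<le> lasso_obj n G D a l \<theta>"
proof -
  define w where "w = (\<lambda>i. \<Sum>k\<in>K. D i k * (\<theta> k - \<phi> k))"
  define u where "u = (\<lambda>i. \<Sum>b\<in>G - K. D i b * \<theta> b)"
  have split: "(\<Sum>k\<in>G. f k) = (\<Sum>k\<in>K. f k) + (\<Sum>k\<in>G - K. f k)" for f :: "nat \<Rightarrow> real"
    using sum.subset_diff[OF KG fin, of f] by simp
  have res: "D i a - (\<Sum>k\<in>G. D i k * \<theta> k) = r i - (w i + u i)" for i
    by (simp add: split r_def w_def u_def algebra_simps sum_subtractf)
  have sq: "(\<Sum>i<n. (r i - (w i + u i))\<^sup>2) = (\<Sum>i<n. (r i)\<^sup>2) - 2 * (\<Sum>i<n. r i * w i)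
       - 2 * (\<Sum>i<n. r i * u i) + (\<Sum>i<n. (w i + u i)\<^sup>2)"
    by (simp add: power2_diff sum.distrib sum_subtractf sum_distrib_left algebra_simps)
  have sq': "(\<Sum>i<n. (r i - (w i + u i) - r i)\<^sup>2) = (\<Sum>i<n. (w i + u i)\<^sup>2)"
    by (rule sum.cong) (auto simp: power2_eq_square algebra_simps)
  have "(\<Sum>i<n. r i * u i) = (\<Sum>b\<in>G - K. \<Sum>i<n. r i * (D i b * \<theta> b))"
    by (subst sum.swap) (simp add: u_def sum_distrib_left)
  also have "\<dots> = (\<Sum>b\<in>G - K. (\<Sum>i<n. r i * D i b) * \<theta> b)"
    by (simp add: sum_distrib_right mult.assoc)
  finally have ru: "(\<Sum>b\<in>G - K. 2 * (\<Sum>i<n. r i * D i b) / real n * \<theta> b)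
       = 2 * (\<Sum>i<n. r i * u i) / real n"
    by (simp add: sum_divide_distrib sum_distrib_left algebra_simps)
  have "2 * (\<Sum>i<n. r i * w i) / real n \<le> l * (\<Sum>k\<in>K. \<bar>\<theta> k\<bar>) - l * (\<Sum>k\<in>K. \<bar>\<phi> k\<bar>)"
    using lasso_variational_inequality[OF min l, of \<theta>] unfolding w_def r_def by simp
  moreover have "lasso_obj n K D a l \<phi> = (\<Sum>i<n. (r i)\<^sup>2) / real n + l * (\<Sum>k\<in>K. \<bar>\<phi> k\<bar>)"
    by (simp add: lasso_obj_def r_def)
  moreover have "lasso_obj n G D a l \<theta> = (\<Sum>i<n. (r i - (w i + u i))\<^sup>2) / real n
      + l * (\<Sum>k\<in>K. \<bar>\<theta> k\<bar>) + l * (\<Sum>k\<in>G - K. \<bar>\<theta> k\<bar>)"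
    by (simp add: lasso_obj_def res split[of "\<lambda>k. \<bar>\<theta> k\<bar>"] distrib_left)
  ultimately show ?thesis
    unfolding res sq sum_subtractf ru sq'
    by (simp add: add_divide_distrib diff_divide_distrib sum_distrib_left)
qed

text \<open>Extended by zero, \<open>\<phi>\<close> competes with \<open>\<theta>\<close> over \<open>G\<close>, so the excess of \<open>\<theta>\<close> is at most zero. The terms of
the excess that belong to predictors outside \<open>K\<close> are nonnegative, and strictly positive wherever
\<open>\<theta>\<close> does not vanish. Every minimiser over \<open>G\<close> is covered, also when there are several.\<close>

lemma lasso_no_spurious_coefficients:
  assumes fin: "finite G" and KG: "K \<subseteq> G" and \<phi>: "lasso_min n K D a l \<phi>" and l: "0 \<le> l"
    and \<theta>: "lasso_min n G D a l \<theta>"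
    and small: "\<And>b. b \<in> G - K \<Longrightarrow>
      \<bar>2 * (\<Sum>i<n. (D i a - (\<Sum>k\<in>K. D i k * \<phi> k)) * D i b) / real n\<bar> < l"
    and b: "b \<in> G - K"
  shows "\<theta> b = 0"
proof (rule ccontr)
  assume nz: "\<theta> b \<noteq> 0"
  define g where "g = (\<lambda>b. 2 * (\<Sum>i<n. (D i a - (\<Sum>k\<in>K. D i k * \<phi> k)) * D i b) / real n)"
  have le: "(l - \<bar>g c\<bar>) * \<bar>\<theta> c\<bar> \<le> l * \<bar>\<theta> c\<bar> - g c * \<theta> c" for c
    using abs_ge_self[of "g c * \<theta> c"] by (simp add: algebra_simps abs_mult)
  have nonneg: "0 \<le> l * \<bar>\<theta> c\<bar> - g c * \<theta> c" if "c \<in> G - K" for c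
    using le[of c] small[OF that] mult_nonneg_nonneg[of "l - \<bar>g c\<bar>" "\<bar>\<theta> c\<bar>"]
    unfolding g_def by linarith
  have "0 < (l - \<bar>g b\<bar>) * \<bar>\<theta> b\<bar>" using small[OF b] nz by (simp add: g_def)
  also have "\<dots> \<le> l * \<bar>\<theta> b\<bar> - g b * \<theta> b" by (rule le)
  also have "\<dots> \<le> (\<Sum>c\<in>G - K. l * \<bar>\<theta> c\<bar> - g c * \<theta> c)"
    using member_le_sum[of b "G - K" "\<lambda>c. l * \<bar>\<theta> c\<bar> - g c * \<theta> c"] nonneg b fin by auto
  finally have pos: "0 < (\<Sum>c\<in>G - K. l * \<bar>\<theta> c\<bar> - g c * \<theta> c)" .
  define \<phi>' where "\<phi>' = (\<lambda>k. if k \<in> K then \<phi> k else 0)"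
  have ext: "(\<Sum>k\<in>G. f k * \<phi>' k) = (\<Sum>k\<in>K. f k * \<phi> k)" for f :: "nat \<Rightarrow> real"
    using fin KG by (intro sum.mono_neutral_cong_right) (auto simp: \<phi>'_def)
  have "(\<Sum>k\<in>G. \<bar>\<phi>' k\<bar>) = (\<Sum>k\<in>K. \<bar>\<phi> k\<bar>)"
    using fin KG by (intro sum.mono_neutral_cong_right) (auto simp: \<phi>'_def)
  then have "lasso_obj n G D a l \<phi>' = lasso_obj n K D a l \<phi>"
    by (simp add: lasso_obj_def ext)
  then have "lasso_obj n G D a l \<theta> \<le> lasso_obj n K D a l \<phi>"
    using \<theta> unfolding lasso_min_def by metis
  moreover have "0 \<le> (\<Sum>i<n. (D i a - (\<Sum>k\<in>G. D i k * \<theta> k) - (D i a - (\<Sum>k\<in>K. D i k * \<phi> k)))\<^sup>2) / real n"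
    by (intro divide_nonneg_nonneg sum_nonneg) auto
  ultimately show False
    using lasso_excess[OF fin KG \<phi> l, of \<theta>] pos unfolding g_def by linarith
qed

lemma lasso_residual_le:
  assumes "lasso_min n K D a l \<phi>" "0 \<le> l" "0 < n"
  shows "(\<Sum>i<n. (D i a - (\<Sum>k\<in>K. D i k * \<phi> k))\<^sup>2) \<le> (\<Sum>i<n. (D i a)\<^sup>2)"
proof -
  have "(\<Sum>i<n. (D i a - (\<Sum>k\<in>K. D i k * \<phi> k))\<^sup>2) / real n \<le> lasso_obj n K D a l \<phi>"
    using assms(2) by (simp add: lasso_obj_def sum_nonneg)
  also have "\<dots> \<le> lasso_obj n K D a l (\<lambda>_. 0)" using assms(1) by (simp add: lasso_min_def)
  finally show ?thesis using assms(3) by (simp add: lasso_obj_def divide_le_cancel)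
qed

lemma is_lasso_imp_lasso_min:
  assumes "is_lasso n p D a l \<theta>"
  shows "lasso_min n ({..<p} - {a}) D a l \<theta>"
  unfolding lasso_min_def
proof
  fix \<psi> :: "nat \<Rightarrow> real"
  define \<psi>' where "\<psi>' = (\<lambda>k. if k < p \<and> k \<noteq> a then \<psi> k else 0)"
  have restr: "(\<Sum>k<p. f k (\<eta> k)) = (\<Sum>k\<in>{..<p} - {a}. f k (\<eta> k))"
    if "\<eta> a = 0" "\<And>k. f k 0 = 0" for \<eta> :: "nat \<Rightarrow> real" and f :: "nat \<Rightarrow> real \<Rightarrow> real"
    using that by (intro sum.mono_neutral_right) auto
  have obj: "lasso_objective n p D a l \<eta> = lasso_obj n ({..<p} - {a}) D a l \<eta>" if "\<eta> a = 0" for \<eta>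
    using restr[of \<eta> "\<lambda>_. abs"] restr[of \<eta> "\<lambda>k x. D _ k * x"] that
    by (simp add: lasso_objective_def lasso_obj_def l1_norm_def)
  have \<theta>: "\<theta> a = 0" "\<And>\<eta>. \<eta> a = 0 \<Longrightarrow> \<forall>k\<ge>p. \<eta> k = 0 \<Longrightarrow> lasso_objective n p D a l \<theta> \<le> lasso_objective n p D a l \<eta>"
    using assms by (auto simp: is_lasso_def is_arg_min_linorder)
  have "lasso_obj n ({..<p} - {a}) D a l \<psi>' = lasso_obj n ({..<p} - {a}) D a l \<psi>"
    unfolding lasso_obj_def by (intro arg_cong2[where f="(+)"] arg_cong2[where f="(/)"]
      arg_cong2[where f="(*)"] sum.cong arg_cong2[where f="(-)"] arg_cong[where f="\<lambda>x. x\<^sup>2"] refl)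
      (auto simp: \<psi>'_def)
  moreover have "lasso_objective n p D a l \<theta> \<le> lasso_objective n p D a l \<psi>'"
    by (rule \<theta>(2)) (auto simp: \<psi>'_def)
  ultimately show "lasso_obj n ({..<p} - {a}) D a l \<theta> \<le> lasso_obj n ({..<p} - {a}) D a l \<psi>"
    using obj[of \<theta>] \<theta>(1) obj[of \<psi>'] by (simp add: \<psi>'_def)
qed

text \<open>A positive penalty makes the objective coercive. The alternative is needed for the data-dependent
penalty, which is zero exactly when the response vanishes; then the zero vector has objective zero.\<close>

lemma lasso_min_exists:
  assumes fin: "finite K" and l: "0 < l \<or> (0 \<le> l \<and> (\<forall>i<n. D i a = 0))"
  shows "\<exists>\<phi>. lasso_min n K D a l \<phi>"
proof (cases "0 < l")
  case False
  have "lasso_min n K D a l (\<lambda>_. 0)"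
    using l False by (auto simp: lasso_min_def lasso_obj_def intro!: add_nonneg_nonneg divide_nonneg_nonneg sum_nonneg)
  then show ?thesis by blast
next
  case True
  \<comment> \<open>a vector with a coordinate beyond \<open>B\<close> pays more penalty than the zero vector has objective\<close>
  define B where "B = lasso_obj n K D a l (\<lambda>_. 0) / l"
  define S where "S = PiE (UNIV :: nat set) (\<lambda>_. {-B..B})"
  have B0: "0 \<le> B" using True by (auto simp: B_def lasso_obj_def intro!: divide_nonneg_nonneg sum_nonneg)
  have "compactin (product_topology (\<lambda>_. euclidean) UNIV) S"
    unfolding S_def by (subst compactin_PiE) auto
  then have "compact S" by (simp add: euclidean_product_topology)
  have cont: "continuous_on S (lasso_obj n K D a l)"
    unfolding lasso_obj_def
    unfolding divide_inverse
    by (intro continuous_on_add continuous_on_mult continuous_on_sum continuous_on_power continuous_on_diff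
      continuous_on_const continuous_on_rabs continuous_on_subset[OF continuous_on_product_coordinates]) auto
  have "S \<noteq> {}" using B0 by (auto simp: S_def PiE_eq_empty_iff)
  then obtain \<phi> where \<phi>: "\<phi> \<in> S" "\<And>\<psi>. \<psi> \<in> S \<Longrightarrow> lasso_obj n K D a l \<phi> \<le> lasso_obj n K D a l \<psi>"
    using continuous_attains_inf[OF \<open>compact S\<close> _ cont] by blast
  have "lasso_min n K D a l \<phi>"
    unfolding lasso_min_def
  proof
    fix \<psi> :: "nat \<Rightarrow> real"
    define \<psi>' where "\<psi>' = (\<lambda>k. if k \<in> K then \<psi> k else 0)"
    have eq: "lasso_obj n K D a l \<psi>' = lasso_obj n K D a l \<psi>"
      by (simp add: lasso_obj_def \<psi>'_def)
    show "lasso_obj n K D a l \<phi> \<le> lasso_obj n K D a l \<psi>"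
    proof (cases "\<forall>k\<in>K. \<bar>\<psi> k\<bar> \<le> B")
      case True
      then have "\<psi>' \<in> S" using B0 by (auto simp: S_def \<psi>'_def abs_le_iff minus_le_iff)
      from \<phi>(2)[OF this] show ?thesis by (simp add: eq)
    next
      case False
      then obtain k where k: "k \<in> K" "B < \<bar>\<psi> k\<bar>" by auto
      have "lasso_obj n K D a l \<phi> \<le> lasso_obj n K D a l (\<lambda>_. 0)"
        using B0 by (intro \<phi>(2)) (auto simp: S_def)
      also have "\<dots> = l * B" using True by (simp add: B_def)
      also have "\<dots> \<le> l * (\<Sum>k\<in>K. \<bar>\<psi> k\<bar>)"
        using k True member_le_sum[of k K "\<lambda>k. \<bar>\<psi> k\<bar>"] fin by (intro mult_left_mono) auto
      also have "\<dots> \<le> lasso_obj n K D a l \<psi>" by (simp add: lasso_obj_def sum_nonneg)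
      finally show ?thesis .
    qed
  qed
  then show ?thesis by blast
qed

section \<open>Measurability of the lasso residual\<close>

lemma lasso_obj_cong:
  assumes "\<And>k. k \<in> K \<Longrightarrow> \<theta> k = \<psi> k"
  shows "lasso_obj n K D a l \<theta> = lasso_obj n K D a l \<psi>"
  using assms by (simp add: lasso_obj_def)

text \<open>The choice of a minimiser is immaterial, since all of them have the same residual.\<close>

definition lasso_residual ::
    "nat \<Rightarrow> nat set \<Rightarrow> (nat \<Rightarrow> nat \<Rightarrow> real) \<Rightarrow> nat \<Rightarrow> real \<Rightarrow> nat \<Rightarrow> real" where
  "lasso_residual n K D a l i = D i a - (\<Sum>k\<in>K. D i k * (SOME \<phi>. lasso_min n K D a l \<phi>) k)"

text \<open>Minimising coefficient vectors need not be unique, but the excess dominates the squared distance of the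
residuals, so near-optimality of the objective forces convergence of the residuals.\<close>

lemma approximate_minimizer_residual:
  assumes fin: "finite K" and min: "lasso_min n K D a l \<phi>" and l: "0 \<le> l" and n: "0 < n" and i: "i < n"
    and conv: "(\<lambda>j. lasso_obj n K D a l (q j)) \<longlonglongrightarrow> lasso_obj n K D a l \<phi>"
  shows "(\<lambda>j. D i a - (\<Sum>k\<in>K. D i k * q j k)) \<longlonglongrightarrow> D i a - (\<Sum>k\<in>K. D i k * \<phi> k)"
proof -
  define r where "r = (\<lambda>i. D i a - (\<Sum>k\<in>K. D i k * \<phi> k))"
  define s where "s = (\<lambda>j i. D i a - (\<Sum>k\<in>K. D i k * q j k))"
  have bound: "\<bar>s j i - r i\<bar> \<le> sqrt (real n * (lasso_obj n K D a l (q j) - lasso_obj n K D a l \<phi>))" for j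
  proof -
    have "(s j i - r i)\<^sup>2 \<le> (\<Sum>i<n. (s j i - r i)\<^sup>2)"
      using i by (intro member_le_sum) auto
    moreover have "(\<Sum>i<n. (s j i - r i)\<^sup>2) / real n \<le> lasso_obj n K D a l (q j) - lasso_obj n K D a l \<phi>"
      using lasso_excess[OF fin order.refl min l, of "q j"] by (simp add: s_def r_def)
    ultimately have "(s j i - r i)\<^sup>2 \<le> real n * (lasso_obj n K D a l (q j) - lasso_obj n K D a l \<phi>)"
      using n by (simp add: field_simps)
    then show ?thesis using real_sqrt_le_mono by fastforce
  qed
  have "(\<lambda>j. sqrt (real n * (lasso_obj n K D a l (q j) - lasso_obj n K D a l \<phi>))) \<longlonglongrightarrow> sqrt (real n * 0)"
    by (intro tendsto_real_sqrt tendsto_mult tendsto_const LIM_zero conv)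
  then have "(\<lambda>j. sqrt (real n * (lasso_obj n K D a l (q j) - lasso_obj n K D a l \<phi>))) \<longlonglongrightarrow> 0" by simp
  then have "(\<lambda>j. s j i - r i) \<longlonglongrightarrow> 0"
    by (rule Lim_null_comparison[OF always_eventually, rotated]) (use bound in auto)
  then have "(\<lambda>j. s j i) \<longlonglongrightarrow> r i" by (simp only: LIM_zero_iff)
  then show ?thesis by (simp only: s_def r_def)
qed

text \<open>The sequence \<open>q\<close> is chosen before the data: only then does the first index with a given property, as a
function of the data, become a measurable choice.\<close>

lemma rational_coefficients_dense:
  assumes "finite K"
  obtains q :: "nat \<Rightarrow> nat \<Rightarrow> real" where
    "\<And>n D a l \<theta> \<epsilon>. 0 < \<epsilon> \<Longrightarrow> \<exists>m. lasso_obj n K D a l (q m) < lasso_obj n K D a l \<theta> + \<epsilon>"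
proof -
  define Q where "Q = PiE K (\<lambda>_. \<rat> :: real set)"
  have cQ: "countable Q" unfolding Q_def using assms by (intro countable_PiE) (auto simp: countable_rat)
  have "\<exists>m. lasso_obj n K D a l (from_nat_into Q m) < lasso_obj n K D a l \<theta> + \<epsilon>" if "0 < \<epsilon>" for n D a l \<theta> \<epsilon>
  proof -
    have "\<exists>f. (\<forall>j. f j \<in> \<rat>) \<and> f \<longlonglongrightarrow> \<theta> k" for k
      using Rats_closure_real closure_sequential[of "\<theta> k" "\<rat>"] by blast
    then obtain f where f: "\<And>k j. f k j \<in> \<rat>" "\<And>k. f k \<longlonglongrightarrow> \<theta> k" by metis
    have "(\<lambda>j. lasso_obj n K D a l (\<lambda>k. f k j)) \<longlonglongrightarrow> lasso_obj n K D a l \<theta>"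
      unfolding lasso_obj_def divide_inverse 
      by (intro tendsto_add tendsto_mult tendsto_sum tendsto_power tendsto_diff tendsto_const tendsto_rabs f)
    then have "\<forall>\<^sub>F j in sequentially. lasso_obj n K D a l (\<lambda>k. f k j) < lasso_obj n K D a l \<theta> + \<epsilon>"
      by (rule order_tendstoD) (use that in simp)
    then obtain j where j: "lasso_obj n K D a l (\<lambda>k. f k j) < lasso_obj n K D a l \<theta> + \<epsilon>"
      using eventually_happens' sequentially_bot by blast
    have "restrict (\<lambda>k. f k j) K \<in> Q" using f(1) by (auto simp: Q_def)
    then obtain m where "from_nat_into Q m = restrict (\<lambda>k. f k j) K"
      using from_nat_into_surj[OF cQ] by blast
    then have "lasso_obj n K D a l (from_nat_into Q m) = lasso_obj n K D a l (\<lambda>k. f k j)"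
      by (auto intro: lasso_obj_cong)
    with j show ?thesis by metis
  qed
  then show thesis by (rule that)
qed

text \<open>The infimum \<open>V\<close> over the sequence \<open>q\<close> is measurable in the data, and so is the first index \<open>J j\<close> at
which the objective is within \<open>1 / (j + 1)\<close> of it. The residuals at these indices converge to the
residual of the lasso, however its coefficient vector was selected.\<close>

lemma measurable_lasso_residual:
  fixes D :: "'x \<Rightarrow> nat \<Rightarrow> nat \<Rightarrow> real"
  assumes fin: "finite K" and n: "0 < n" and i: "i < n"
    and D: "\<And>i k. i < n \<Longrightarrow> k \<in> insert a K \<Longrightarrow> (\<lambda>x. D x i k) \<in> borel_measurable N"
    and l[measurable]: "l \<in> borel_measurable N"
    and l0: "\<And>x. x \<in> space N \<Longrightarrow> 0 \<le> l x"
    and ex: "\<And>x. x \<in> space N \<Longrightarrow> \<exists>\<phi>. lasso_min n K (D x) a (l x) \<phi>"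
  shows "(\<lambda>x. lasso_residual n K (D x) a (l x) i) \<in> borel_measurable N"
proof -
  obtain q :: "nat \<Rightarrow> nat \<Rightarrow> real" where
    q: "\<And>n D a l \<theta> \<epsilon>. 0 < \<epsilon> \<Longrightarrow> \<exists>m. lasso_obj n K D a l (q m) < lasso_obj n K D a l \<theta> + \<epsilon>"
    using rational_coefficients_dense[OF fin] by metis
  define F where "F = (\<lambda>m x. lasso_obj n K (D x) a (l x) (q m))"
  define V where "V = (\<lambda>x. INF m. F m x)"
  define J where "J = (\<lambda>j x. LEAST m. F m x < V x + 1 / real (Suc j))"
  define s where "s = (\<lambda>j x. D x i a - (\<Sum>k\<in>K. D x i k * q (J j x) k))"
  have F[measurable]: "F m \<in> borel_measurable N" for m
    unfolding F_def lasso_obj_def using l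
    by (intro borel_measurable_add borel_measurable_divide borel_measurable_sum borel_measurable_power
      borel_measurable_diff borel_measurable_times D borel_measurable_const) auto
  have [measurable]: "V \<in> borel_measurable N" unfolding V_def by measurable
  have [measurable]: "J j \<in> measurable N (count_space UNIV)" for j unfolding J_def by measurable
  have "s j \<in> borel_measurable N" for j
  proof -
    have D_i: "(\<lambda>x. D x i k) \<in> borel_measurable N" if "k \<in> insert a K" for k
      using D[OF i that] .
    have "(\<lambda>x. q (J j x) k) \<in> borel_measurable N" for k
      by measurable
    then show ?thesis
      unfolding s_def by (intro borel_measurable_diff borel_measurable_sum borel_measurable_times D_i) auto
  qed
  moreover have "(\<lambda>j. s j x) \<longlonglongrightarrow> lasso_residual n K (D x) a (l x) i" if x: "x \<in> space N" for x
  proof -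
    define \<phi> where "\<phi> = (SOME \<phi>. lasso_min n K (D x) a (l x) \<phi>)"
    have \<phi>: "lasso_min n K (D x) a (l x) \<phi>" unfolding \<phi>_def by (rule someI_ex[OF ex[OF x]])
    let ?L = "lasso_obj n K (D x) a (l x)"
    have lower: "?L \<phi> \<le> F m x" for m using \<phi> by (simp add: lasso_min_def F_def)
    have V: "V x = ?L \<phi>"
    proof (rule antisym)
      show "?L \<phi> \<le> V x" unfolding V_def using lower by (intro cINF_greatest) auto
      show "V x \<le> ?L \<phi>"
      proof (rule field_le_epsilon)
        fix e :: real assume "0 < e"
        then obtain m where "F m x < ?L \<phi> + e" using q unfolding F_def by metis
        moreover have "V x \<le> F m x" unfolding V_def
          using lower by (intro cINF_lower) (auto intro!: bdd_belowI)
        ultimately show "V x \<le> ?L \<phi> + e" by simp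
      qed
    qed
    have "F (J j x) x < V x + 1 / real (Suc j)" for j
      unfolding J_def
    proof (rule LeastI_ex)
      show "\<exists>m. F m x < V x + 1 / real (Suc j)" unfolding F_def V by (rule q) simp
    qed
    then have up: "F (J j x) x \<le> ?L \<phi> + 1 / real (Suc j)" for j using less_imp_le unfolding V by metis
    have "(\<lambda>j. F (J j x) x) \<longlonglongrightarrow> ?L \<phi>"
    proof (rule tendsto_sandwich[OF always_eventually always_eventually tendsto_const[of "?L \<phi>"]])
      show "(\<lambda>j. ?L \<phi> + 1 / real (Suc j)) \<longlonglongrightarrow> ?L \<phi>"
        using tendsto_add[OF tendsto_const LIMSEQ_inverse_real_of_nat, of "?L \<phi>"] by (simp add: inverse_eq_divide)
    qed (use lower up in auto)
    from approximate_minimizer_residual[OF fin \<phi> l0[OF x] n i this[unfolded F_def]]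
    show ?thesis by (simp add: s_def lasso_residual_def \<phi>_def)
  qed
  ultimately show ?thesis by (rule borel_measurable_LIMSEQ_real[rotated])
qed

section \<open>Gaussian densities, their marginals and blocks\<close>

definition pair_form :: "nat set \<Rightarrow> (nat \<Rightarrow> nat \<Rightarrow> real) \<Rightarrow> (nat \<Rightarrow> real) \<Rightarrow> real" where
  "pair_form I A x = (\<Sum>i\<in>I. \<Sum>j\<in>I. x i * A i j * x j)"

definition gauss_kernel :: "nat set \<Rightarrow> real \<Rightarrow> (nat \<Rightarrow> nat \<Rightarrow> real) \<Rightarrow> (nat \<Rightarrow> real) \<Rightarrow> real" where
  "gauss_kernel I c A x = c * exp (- pair_form I A x / 2)"

lemma pair_form_insert:
  assumes "finite I" "i \<notin> I"
  shows "pair_form (insert i I) A (x(i := t)) =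
    A i i * t\<^sup>2 + (\<Sum>j\<in>I. (A i j + A j i) * x j) * t + pair_form I A x"
proof -
  have ne: "j \<noteq> i" if "j \<in> I" for j using that assms(2) by auto
  have "pair_form (insert i I) A (x(i := t)) =
     t * A i i * t + (\<Sum>j\<in>I. t * A i j * x j) + (\<Sum>j\<in>I. x j * A j i * t + (\<Sum>k\<in>I. x j * A j k * x k))"
    unfolding pair_form_def using assms ne by (simp cong: sum.cong)
  then show ?thesis
    by (simp add: pair_form_def sum.distrib sum_distrib_right sum_distrib_left power2_eq_square algebra_simps)
qed

lemma measurable_pair_form[measurable]:
  assumes "finite I" "I \<subseteq> J"
  shows "pair_form I A \<in> borel_measurable (Pi\<^sub>M J (\<lambda>_. lborel))"
proof -
  have [measurable]: "(\<lambda>x. x i) \<in> borel_measurable (Pi\<^sub>M J (\<lambda>_. lborel :: real measure))" if "i \<in> I" for i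
    using measurable_component_singleton[of i J "\<lambda>_. lborel"] that assms(2) by auto
  show ?thesis unfolding pair_form_def using assms(1) by (intro borel_measurable_sum borel_measurable_times) auto
qed

lemma nn_integral_gaussian_quadratic:
  fixes q b d :: real
  assumes "0 < q"
  shows "(\<integral>\<^sup>+t. ennreal (exp (- (q * t\<^sup>2 + b * t + d) / 2)) \<partial>lborel)
           = ennreal (sqrt (2 * pi / q) * exp (- (d - b\<^sup>2 / (4 * q)) / 2))"
proof -
  define \<sigma> where "\<sigma> = 1 / sqrt q"
  define \<mu> where "\<mu> = - b / (2 * q)"
  have \<sigma>: "0 < \<sigma>" using assms by (simp add: \<sigma>_def)
  have \<sigma>2: "\<sigma>\<^sup>2 = 1 / q" using assms by (simp add: \<sigma>_def power_divide)
  have "exp (- (q * t\<^sup>2 + b * t + d) / 2)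
      = (sqrt (2 * pi / q) * exp (- (d - b\<^sup>2 / (4 * q)) / 2)) * normal_density \<mu> \<sigma> t" for t
  proof -
    have "- (t - \<mu>)\<^sup>2 / (2 * \<sigma>\<^sup>2) = - (q * (t - \<mu>)\<^sup>2) / 2" unfolding \<sigma>2 by simp
    moreover have "q * t\<^sup>2 + b * t + d = (d - b\<^sup>2 / (4 * q)) + q * (t - \<mu>)\<^sup>2"
      using assms by (simp add: \<mu>_def field_simps power2_eq_square)
    ultimately have "- (q * t\<^sup>2 + b * t + d) / 2 = - (d - b\<^sup>2 / (4 * q)) / 2 + - (t - \<mu>)\<^sup>2 / (2 * \<sigma>\<^sup>2)"
      by (simp add: field_simps)
    then have "exp (- (q * t\<^sup>2 + b * t + d) / 2)
        = exp (- (d - b\<^sup>2 / (4 * q)) / 2) * exp (- (t - \<mu>)\<^sup>2 / (2 * \<sigma>\<^sup>2))"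
      by (simp only: exp_add)
    then show ?thesis using assms unfolding normal_density_def by (simp add: \<sigma>2 real_sqrt_divide real_sqrt_mult)
  qed
  then have "(\<integral>\<^sup>+t. ennreal (exp (- (q * t\<^sup>2 + b * t + d) / 2)) \<partial>lborel)
     = (\<integral>\<^sup>+t. ennreal (sqrt (2 * pi / q) * exp (- (d - b\<^sup>2 / (4 * q)) / 2)) * ennreal (normal_density \<mu> \<sigma> t) \<partial>lborel)"
    using assms by (intro nn_integral_cong) (simp add: ennreal_mult')
  also have "\<dots> = ennreal (sqrt (2 * pi / q) * exp (- (d - b\<^sup>2 / (4 * q)) / 2)) *
      (\<integral>\<^sup>+t. ennreal (normal_density \<mu> \<sigma> t) \<partial>lborel)"
    by (rule nn_integral_cmult) simp
  also have "(\<integral>\<^sup>+t. ennreal (normal_density \<mu> \<sigma> t) \<partial>lborel) = 1"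
    using nn_integral_eq_integral[OF integrable_normal_density[OF \<sigma>, of \<mu>]] integral_normal_density[OF \<sigma>, of \<mu>]
    by simp
  finally show ?thesis by simp
qed

lemma ennreal_eq_top_of_nat:
  fixes x :: ennreal
  assumes "\<And>N. of_nat N \<le> x"
  shows "x = \<infinity>"
  using assms ennreal_Ex_less_of_nat[of x] by (metis infinity_ennreal_def leD less_top)

lemma nn_integral_nongaussian_quadratic:
  fixes q b d :: real
  assumes "q \<le> 0"
  shows "(\<integral>\<^sup>+t. ennreal (exp (- (q * t\<^sup>2 + b * t + d) / 2)) \<partial>lborel) = \<infinity>"
proof -
  define H where "H = (if b \<le> 0 then {0::real..} else {..0})"
  have "emeasure lborel {0::real..} = \<infinity>"
  proof (rule ennreal_eq_top_of_nat)
    fix N have "emeasure lborel {0..real N} \<le> emeasure lborel {0::real..}" by (intro emeasure_mono) auto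
    then show "of_nat N \<le> emeasure lborel {0::real..}" by (simp add: ennreal_of_nat_eq_real_of_nat)
  qed
  moreover have "emeasure lborel {..0::real} = \<infinity>"
  proof (rule ennreal_eq_top_of_nat)
    fix N have "emeasure lborel {- real N..0} \<le> emeasure lborel {..0::real}" by (intro emeasure_mono) auto
    then show "of_nat N \<le> emeasure lborel {..0::real}" by (simp add: ennreal_of_nat_eq_real_of_nat)
  qed
  ultimately have H: "H \<in> sets borel" "emeasure lborel H = \<infinity>" by (auto simp: H_def)
  have "ennreal (exp (- d / 2)) * indicator H t \<le> ennreal (exp (- (q * t\<^sup>2 + b * t + d) / 2))" for t
  proof (cases "t \<in> H")
    case True
    then have "b * t \<le> 0" by (auto simp: H_def mult_le_0_iff split: if_splits)
    moreover have "q * t\<^sup>2 \<le> 0" using assms by (simp add: mult_nonpos_nonneg)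
    ultimately show ?thesis using True by (simp add: ennreal_leI)
  qed simp
  then have "(\<integral>\<^sup>+t. ennreal (exp (- d / 2)) * indicator H t \<partial>lborel)
       \<le> (\<integral>\<^sup>+t. ennreal (exp (- (q * t\<^sup>2 + b * t + d) / 2)) \<partial>lborel)"
    by (intro nn_integral_mono) auto
  moreover have "(\<integral>\<^sup>+t. ennreal (exp (- d / 2)) * indicator H t \<partial>lborel) = \<infinity>"
    using H by (subst nn_integral_cmult_indicator) (auto simp: ennreal_mult_top)
  ultimately show ?thesis by (simp add: top_unique)
qed

text \<open>Gaussian laws are described by the matrix \<open>A\<close> in the exponent of the density, not by a covariance
matrix. The class is closed under marginals by completing the square, without any matrix inversion.
The coefficient of \<open>x i * x j\<close> in the exponent is, up to the factor \<open>- 1 / 2\<close>, the sum \<open>A i j + A j i\<close>;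
that there is no cross term is therefore expressed by the vanishing of this sum.\<close>

definition gaussian_vector ::
    "'a measure \<Rightarrow> nat set \<Rightarrow> (nat \<Rightarrow> 'a \<Rightarrow> real) \<Rightarrow> real \<Rightarrow> (nat \<Rightarrow> nat \<Rightarrow> real) \<Rightarrow> bool" where
  "gaussian_vector M I X c A \<longleftrightarrow> finite I \<and> 0 < c \<and>
     distributed M (\<Pi>\<^sub>M i\<in>I. lborel) (random_vector I X) (\<lambda>x. ennreal (gauss_kernel I c A x))"

lemma restrict_random_vector: "J \<subseteq> I \<Longrightarrow> restrict (random_vector I X \<omega>) J = random_vector J X \<omega>"
  by (auto simp: random_vector_def restrict_def fun_eq_iff)

lemma sets_PiM_lborel: "sets (\<Pi>\<^sub>M i\<in>I. lborel) = sets (\<Pi>\<^sub>M i\<in>I. (borel :: real measure))"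
  by (rule sets_PiM_cong) auto

interpretation lborel_prod: product_sigma_finite "\<lambda>_::nat. lborel :: real measure" ..

text \<open>Completing the square in the coordinate \<open>t\<close> leaves the Schur complement of \<open>A i i\<close>. If \<open>A i i\<close> is not
positive, the integrand stays bounded away from zero on a half-line.\<close>

lemma gauss_kernel_insert:
  assumes "finite I" "i \<notin> I" "0 < c"
  shows "(\<integral>\<^sup>+t. ennreal (gauss_kernel (insert i I) c A (x(i := t))) \<partial>lborel) =
    (if 0 < A i i then
       ennreal (gauss_kernel I (c * sqrt (2 * pi / A i i))
         (\<lambda>j k. A j k - (A i j + A j i) * (A i k + A k i) / (4 * A i i)) x)
     else \<infinity>)"
proof -
  define b where "b = (\<Sum>j\<in>I. (A i j + A j i) * x j)"
  define d where "d = pair_form I A x"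
  have "(\<integral>\<^sup>+t. ennreal (gauss_kernel (insert i I) c A (x(i := t))) \<partial>lborel)
      = (\<integral>\<^sup>+t. ennreal c * ennreal (exp (- (A i i * t\<^sup>2 + b * t + d) / 2)) \<partial>lborel)"
    using assms by (simp add: gauss_kernel_def pair_form_insert b_def d_def ennreal_mult')
  also have "\<dots> = ennreal c * (\<integral>\<^sup>+t. ennreal (exp (- (A i i * t\<^sup>2 + b * t + d) / 2)) \<partial>lborel)"
    by (rule nn_integral_cmult) simp
  finally have *: "(\<integral>\<^sup>+t. ennreal (gauss_kernel (insert i I) c A (x(i := t))) \<partial>lborel) = \<dots>" .
  show ?thesis
  proof (cases "0 < A i i")
    case True
    have "b\<^sup>2 = (\<Sum>j\<in>I. \<Sum>k\<in>I. x j * ((A i j + A j i) * (A i k + A k i)) * x k)"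
      by (simp add: b_def power2_eq_square sum_product mult_ac)
    then have "pair_form I (\<lambda>j k. A j k - (A i j + A j i) * (A i k + A k i) / (4 * A i i)) x
        = d - b\<^sup>2 / (4 * A i i)"
      by (simp add: pair_form_def d_def sum_subtractf right_diff_distrib left_diff_distrib sum_divide_distrib)
    then show ?thesis
      unfolding * nn_integral_gaussian_quadratic[OF True] using True assms(3)
      by (simp add: gauss_kernel_def ennreal_mult'[symmetric] mult.assoc)
  next
    case False
    then show ?thesis
      unfolding * using assms(3) nn_integral_nongaussian_quadratic[of "A i i" b d]
      by (simp add: ennreal_mult_top)
  qed
qed

lemma measurable_gauss_kernel[measurable]:
  assumes "finite I" "I \<subseteq> J"
  shows "gauss_kernel I c A \<in> borel_measurable (Pi\<^sub>M J (\<lambda>_. lborel))"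
  using measurable_pair_form[OF assms] unfolding gauss_kernel_def by measurable

text \<open>The coordinate \<open>i\<close> is integrated out. Its diagonal entry is positive because otherwise the total mass
would be infinite.\<close>

lemma gaussian_vector_insertD:
  assumes M: "prob_space M" and g: "gaussian_vector M (insert i I) X c A" and i: "i \<notin> I"
  shows "0 < A i i" "\<exists>c' A'. gaussian_vector M I X c' A'"
proof -
  interpret prob_space M by fact
  have fin: "finite I" and c: "0 < c"
    and d: "distributed M (\<Pi>\<^sub>M i\<in>insert i I. lborel) (random_vector (insert i I) X)
      (\<lambda>x. ennreal (gauss_kernel (insert i I) c A x))"
    using g by (auto simp: gaussian_vector_def)
  let ?N = "\<Pi>\<^sub>M i\<in>I. lborel :: real measure"
  define h where "h = (\<lambda>x. \<integral>\<^sup>+t. ennreal (gauss_kernel (insert i I) c A (x(i := t))) \<partial>lborel)"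
  have rv[measurable]: "random_vector (insert i I) X \<in> measurable M (\<Pi>\<^sub>M i\<in>insert i I. lborel)"
    using d by (rule distributed_measurable)
  have rvI: "random_vector I X \<in> measurable M ?N"
    using measurable_compose[OF rv measurable_restrict_subset[of I]]
    by (simp add: restrict_random_vector subset_insertI)
  have hm[measurable]: "h \<in> borel_measurable ?N"
  proof -
    have [measurable]: "(\<lambda>(x, t). x(i := t)) \<in> measurable (?N \<Otimes>\<^sub>M lborel) (\<Pi>\<^sub>M i\<in>insert i I. lborel)"
      using measurable_add_dim[of i I "\<lambda>_. lborel"] by simp
    have "(\<lambda>(x, t). ennreal (gauss_kernel (insert i I) c A (x(i := t)))) \<in> borel_measurable (?N \<Otimes>\<^sub>M lborel)"
      using measurable_compose[OF \<open>(\<lambda>(x, t). x(i := t)) \<in> _\<close> measurable_gauss_kernel[of "insert i I" "insert i I" c A]] fin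
      by (simp add: case_prod_beta')
    then show ?thesis unfolding h_def by (intro sigma_finite_measure.borel_measurable_nn_integral) (auto intro: sigma_finite_lborel)
  qed
  have eq: "emeasure M (random_vector I X -` S \<inter> space M) = (\<integral>\<^sup>+x. h x * indicator S x \<partial>?N)"
    if S[measurable]: "S \<in> sets ?N" for S
  proof -
    let ?S = "(\<lambda>x. restrict x I) -` S \<inter> space (\<Pi>\<^sub>M i\<in>insert i I. lborel)"
    have S': "?S \<in> sets (\<Pi>\<^sub>M i\<in>insert i I. lborel)"
      by (rule measurable_sets[OF measurable_restrict_subset S]) auto
    have "random_vector I X -` S \<inter> space M = random_vector (insert i I) X -` ?S \<inter> space M"
      using measurable_space[OF rv] by (auto simp: restrict_random_vector subset_insertI)
    then have "emeasure M (random_vector I X -` S \<inter> space M)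
        = (\<integral>\<^sup>+x. ennreal (gauss_kernel (insert i I) c A x) * indicator ?S x \<partial>(\<Pi>\<^sub>M i\<in>insert i I. lborel))"
      using distributed_emeasure[OF d S'] by simp
    also have "\<dots> = (\<integral>\<^sup>+x. \<integral>\<^sup>+t. ennreal (gauss_kernel (insert i I) c A (x(i := t))) * indicator ?S (x(i := t)) \<partial>lborel \<partial>?N)"
      using fin i S' measurable_gauss_kernel[of "insert i I" "insert i I" c A]
      by (intro lborel_prod.product_nn_integral_insert) auto
    also have "\<dots> = (\<integral>\<^sup>+x. \<integral>\<^sup>+t. ennreal (gauss_kernel (insert i I) c A (x(i := t))) * indicator S x \<partial>lborel \<partial>?N)"
    proof (intro nn_integral_cong)
      fix x and t :: real assume x: "x \<in> space ?N"
      then have "restrict (x(i := t)) I = x" using i by (auto simp: space_PiM PiE_def extensional_def restrict_def fun_eq_iff)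
      moreover have "x(i := t) \<in> space (\<Pi>\<^sub>M i\<in>insert i I. lborel)"
        using x by (auto simp: space_PiM PiE_def extensional_def)
      ultimately show "ennreal (gauss_kernel (insert i I) c A (x(i := t))) * indicator ?S (x(i := t))
          = ennreal (gauss_kernel (insert i I) c A (x(i := t))) * indicator S x"
        by (auto simp: indicator_def)
    qed
    also have "\<dots> = (\<integral>\<^sup>+x. h x * indicator S x \<partial>?N)"
    proof (intro nn_integral_cong)
      fix x assume x: "x \<in> space ?N"
      have "(\<lambda>t. x(i := t)) \<in> measurable lborel (\<Pi>\<^sub>M i\<in>insert i I. lborel)"
        using measurable_component_update[OF x i] by simp
      from measurable_compose[OF this measurable_gauss_kernel[of "insert i I" "insert i I" c A]]
      show "(\<integral>\<^sup>+t. ennreal (gauss_kernel (insert i I) c A (x(i := t))) * indicator S x \<partial>lborel) = h x * indicator S x"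
        unfolding h_def using fin by (intro nn_integral_multc) auto
    qed
    finally show ?thesis .
  qed
  have total: "(\<integral>\<^sup>+x. h x \<partial>?N) = 1"
  proof -
    have "random_vector I X -` space ?N \<inter> space M = space M" using measurable_space[OF rvI] by auto
    then show ?thesis using eq[of "space ?N"] by (simp add: emeasure_space_1 cong: nn_integral_cong)
  qed
  show pos: "0 < A i i"
  proof (rule ccontr)
    assume "\<not> 0 < A i i"
    then have "h x = \<infinity>" for x unfolding h_def gauss_kernel_insert[OF fin i c] by simp
    then have "(\<integral>\<^sup>+x. h x \<partial>?N) = \<infinity> * emeasure ?N (space ?N)" by simp
    then show False using total by (auto simp: ennreal_top_mult split: if_splits)
  qed
  define c' where "c' = c * sqrt (2 * pi / A i i)"
  define A' where "A' = (\<lambda>j k. A j k - (A i j + A j i) * (A i k + A k i) / (4 * A i i))"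
  have h: "h x = ennreal (gauss_kernel I c' A' x)" for x
    unfolding h_def gauss_kernel_insert[OF fin i c] c'_def A'_def using pos by simp
  have "distributed M ?N (random_vector I X) (\<lambda>x. ennreal (gauss_kernel I c' A' x))"
    unfolding distributed_def
  proof (intro conjI)
    show "distr M ?N (random_vector I X) = density ?N (\<lambda>x. ennreal (gauss_kernel I c' A' x))"
    proof (rule measure_eqI)
      fix S assume "S \<in> sets (distr M ?N (random_vector I X))"
      then have S: "S \<in> sets ?N" by simp
      show "emeasure (distr M ?N (random_vector I X)) S = emeasure (density ?N (\<lambda>x. ennreal (gauss_kernel I c' A' x))) S"
        using S eq[OF S] hm by (simp add: emeasure_distr rvI emeasure_density h[symmetric])
    qed simp
    show "(\<lambda>x. ennreal (gauss_kernel I c' A' x)) \<in> borel_measurable ?N" using hm by (simp add: h[symmetric])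
  qed (rule rvI)
  moreover have "0 < c'" using c pos by (simp add: c'_def)
  ultimately show "\<exists>c' A'. gaussian_vector M I X c' A'" using fin by (auto simp: gaussian_vector_def)
qed

lemma gaussian_vector_subset:
  assumes "prob_space M" and "gaussian_vector M I X c A" and "J \<subseteq> I"
  shows "\<exists>c' A'. gaussian_vector M J X c' A'"
proof -
  have "finite (I - J)" using assms(2) by (auto simp: gaussian_vector_def)
  then have "\<forall>c A. gaussian_vector M (J \<union> (I - J)) X c A \<longrightarrow> (\<exists>c' A'. gaussian_vector M J X c' A')"
  proof (rule finite_subset_induct'[where A = "I - J", OF _ order.refl])
    fix i F assume i: "i \<in> I - J" "i \<notin> F"
      and IH: "\<forall>c A. gaussian_vector M (J \<union> F) X c A \<longrightarrow> (\<exists>c' A'. gaussian_vector M J X c' A')"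
    have "i \<notin> J \<union> F" using i by auto
    then show "\<forall>c A. gaussian_vector M (J \<union> insert i F) X c A \<longrightarrow> (\<exists>c' A'. gaussian_vector M J X c' A')"
      using gaussian_vector_insertD(2)[OF assms(1), of i "J \<union> F"] IH by (metis Un_insert_right)
  qed auto
  moreover have "J \<union> (I - J) = I" using assms(3) by auto
  ultimately show ?thesis using assms(2) by metis
qed

text \<open>After all other coordinates are integrated out, the density is \<open>c' * exp (- q * t\<^sup>2 / 2)\<close> with
\<open>q > 0\<close>, and the total mass determines \<open>c'\<close>.\<close>

lemma gaussian_vector_component_normal:
  assumes M: "prob_space M" and g: "gaussian_vector M I X c A" and b: "b \<in> I"
  shows "\<exists>\<sigma>>0. distributed M lborel (X b) (\<lambda>x. ennreal (normal_density 0 \<sigma> x))"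
proof -
  interpret prob_space M by fact
  obtain c' A' where g': "gaussian_vector M {b} X c' A'"
    using gaussian_vector_subset[OF M g, of "{b}"] b by auto
  then have d: "distributed M (\<Pi>\<^sub>M i\<in>{b}. lborel) (random_vector {b} X) (\<lambda>x. ennreal (gauss_kernel {b} c' A' x))"
    and c': "0 < c'" by (auto simp: gaussian_vector_def)
  have q: "0 < A' b b" using gaussian_vector_insertD(1)[OF M g'] by simp
  define \<sigma> where "\<sigma> = 1 / sqrt (A' b b)"
  define e where "e = c' * sqrt (2 * pi / A' b b)"
  have \<sigma>: "0 < \<sigma>" using q by (simp add: \<sigma>_def)
  have e: "0 \<le> e" using c' q by (simp add: e_def)
  have \<sigma>2: "\<sigma>\<^sup>2 = 1 / A' b b" using q by (simp add: \<sigma>_def power_divide)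
  have k: "c' * exp (- (t * A' b b * t) / 2) = e * normal_density 0 \<sigma> t" for t
    unfolding normal_density_def \<sigma>2 e_def using q
    by (simp add: real_sqrt_divide real_sqrt_mult power2_eq_square)
  have rv: "random_vector {b} X \<in> measurable M (\<Pi>\<^sub>M i\<in>{b}. lborel)"
    using d by (rule distributed_measurable)
  have comp: "(\<lambda>x. x b) \<in> measurable (\<Pi>\<^sub>M i\<in>{b}. lborel :: real measure) lborel"
    by (rule measurable_component_singleton) simp
  have Xb: "X b \<in> measurable M lborel"
    using measurable_compose[OF rv comp] by (simp add: random_vector_def)
  have eq: "emeasure M (X b -` S \<inter> space M) = ennreal e * (\<integral>\<^sup>+t. ennreal (normal_density 0 \<sigma> t) * indicator S t \<partial>lborel)"
    if S[measurable]: "S \<in> sets borel" for S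
  proof -
    let ?S = "(\<lambda>x. x b) -` S \<inter> space (\<Pi>\<^sub>M i\<in>{b}. lborel :: real measure)"
    have S': "?S \<in> sets (\<Pi>\<^sub>M i\<in>{b}. lborel)" using comp S by (auto intro: measurable_sets)
    have "X b -` S \<inter> space M = random_vector {b} X -` ?S \<inter> space M"
      using measurable_space[OF rv] by (auto simp: random_vector_def)
    then have "emeasure M (X b -` S \<inter> space M)
        = (\<integral>\<^sup>+x. ennreal (gauss_kernel {b} c' A' x) * indicator ?S x \<partial>(\<Pi>\<^sub>M i\<in>{b}. lborel))"
      using distributed_emeasure[OF d S'] by simp
    also have "\<dots> = (\<integral>\<^sup>+x. ennreal (e * normal_density 0 \<sigma> (x b)) * indicator S (x b) \<partial>(\<Pi>\<^sub>M i\<in>{b}. lborel))"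
      by (intro nn_integral_cong) (auto simp: gauss_kernel_def pair_form_def k[symmetric] indicator_def)
    also have "\<dots> = (\<integral>\<^sup>+t. ennreal (e * normal_density 0 \<sigma> t) * indicator S t \<partial>lborel)"
      by (intro lborel_prod.product_nn_integral_singleton) auto
    also have "\<dots> = (\<integral>\<^sup>+t. ennreal e * (ennreal (normal_density 0 \<sigma> t) * indicator S t) \<partial>lborel)"
      using e by (simp add: ennreal_mult' mult.assoc)
    also have "\<dots> = ennreal e * (\<integral>\<^sup>+t. ennreal (normal_density 0 \<sigma> t) * indicator S t \<partial>lborel)"
      by (rule nn_integral_cmult) auto
    finally show ?thesis .
  qed
  have "(\<integral>\<^sup>+t. ennreal (normal_density 0 \<sigma> t) \<partial>lborel) = 1"
    using nn_integral_eq_integral[OF integrable_normal_density[OF \<sigma>, of 0]] integral_normal_density[OF \<sigma>, of 0]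
    by simp
  then have "ennreal e = 1" using eq[of UNIV] by (simp add: emeasure_space_1)
  then have eq1: "emeasure M (X b -` S \<inter> space M) = (\<integral>\<^sup>+t. ennreal (normal_density 0 \<sigma> t) * indicator S t \<partial>lborel)"
    if "S \<in> sets borel" for S using eq[OF that] by simp
  have "distributed M lborel (X b) (\<lambda>x. ennreal (normal_density 0 \<sigma> x))"
    unfolding distributed_def
  proof (intro conjI)
    show "distr M lborel (X b) = density lborel (\<lambda>x. ennreal (normal_density 0 \<sigma> x))"
    proof (rule measure_eqI)
      fix S assume "S \<in> sets (distr M lborel (X b))"
      then have S: "S \<in> sets borel" by simp
      show "emeasure (distr M lborel (X b)) S = emeasure (density lborel (\<lambda>x. ennreal (normal_density 0 \<sigma> x))) S"
        using S eq1[OF S] Xb by (simp add: emeasure_distr emeasure_density)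
    qed simp
  qed (use Xb in auto)
  then show ?thesis using \<sigma> by blast
qed

lemma gaussian_vector_component_std_normal:
  assumes M: "prob_space M" and g: "gaussian_vector M I X c A" and b: "b \<in> I"
    and v: "prob_space.variance M (X b) = 1"
  shows "distributed M lborel (X b) (\<lambda>x. ennreal (std_normal_density x))"
proof -
  interpret prob_space M by fact
  obtain \<sigma> where \<sigma>: "0 < \<sigma>" and d: "distributed M lborel (X b) (\<lambda>x. ennreal (normal_density 0 \<sigma> x))"
    using gaussian_vector_component_normal[OF M g b] by blast
  have "variance (X b) = \<sigma>\<^sup>2" using normal_distributed_variance[OF \<sigma> d] .
  then have "\<sigma> = 1" using v \<sigma> by (simp add: power2_eq_1_iff)
  with d show ?thesis by simp
qed

lemma pair_form_merge:
  assumes "C \<inter> B = {}" "finite C" "finite B"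
    and cross: "\<And>i j. i \<in> C \<Longrightarrow> j \<in> B \<Longrightarrow> A i j + A j i = 0"
  shows "pair_form (C \<union> B) A (merge C B (x, y)) = pair_form C A x + pair_form B A y"
proof -
  let ?m = "merge C B (x, y)"
  have mC: "?m i = x i" if "i \<in> C" for i using that by (simp add: merge_def)
  have mB: "?m i = y i" if "i \<in> B" for i using that assms(1) by (auto simp: merge_def)
  have "pair_form (C \<union> B) A ?m = pair_form C A x + pair_form B A y
      + ((\<Sum>i\<in>C. \<Sum>j\<in>B. x i * A i j * y j) + (\<Sum>i\<in>B. \<Sum>j\<in>C. y i * A i j * x j))"
    using assms(1-3) by (simp add: pair_form_def sum.union_disjoint sum.distrib mC mB cong: sum.cong)
  also have "(\<Sum>i\<in>B. \<Sum>j\<in>C. y i * A i j * x j) = (\<Sum>i\<in>C. \<Sum>j\<in>B. y j * A j i * x i)"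
    by (rule sum.swap)
  also have "(\<Sum>i\<in>C. \<Sum>j\<in>B. x i * A i j * y j) + (\<Sum>i\<in>C. \<Sum>j\<in>B. y j * A j i * x i)
      = (\<Sum>i\<in>C. \<Sum>j\<in>B. (A i j + A j i) * (x i * y j))"
    by (simp add: sum.distrib[symmetric] algebra_simps)
  also have "\<dots> = 0" using cross by (simp cong: sum.cong)
  finally show ?thesis by simp
qed

text \<open>Without cross terms the density is a product, so the probability of a product event has the form
\<open>c * G S * H T\<close>. The product formula follows by comparing the cases where \<open>S\<close> or \<open>T\<close> is the whole space;
the normalising constants of the two factors never have to be identified.\<close>

lemma gaussian_blocks_prob:
  assumes M: "prob_space M" and g: "gaussian_vector M (C \<union> B) X c A" and disj: "C \<inter> B = {}"
    and cross: "\<And>i j. i \<in> C \<Longrightarrow> j \<in> B \<Longrightarrow> A i j + A j i = 0"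
    and S: "S \<in> sets (\<Pi>\<^sub>M i\<in>C. borel)" and T: "T \<in> sets (\<Pi>\<^sub>M i\<in>B. borel)"
  shows "measure M {\<omega>\<in>space M. random_vector C X \<omega> \<in> S \<and> random_vector B X \<omega> \<in> T} =
    measure M {\<omega>\<in>space M. random_vector C X \<omega> \<in> S} * measure M {\<omega>\<in>space M. random_vector B X \<omega> \<in> T}"
proof -
  interpret prob_space M by fact
  have fin: "finite C" "finite B" and c: "0 < c"
    and d: "distributed M (\<Pi>\<^sub>M i\<in>C \<union> B. lborel) (random_vector (C \<union> B) X) (\<lambda>x. ennreal (gauss_kernel (C \<union> B) c A x))"
    using g by (auto simp: gaussian_vector_def)
  let ?NC = "\<Pi>\<^sub>M i\<in>C. lborel :: real measure" and ?NB = "\<Pi>\<^sub>M i\<in>B. lborel :: real measure"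
    and ?N = "\<Pi>\<^sub>M i\<in>C \<union> B. lborel :: real measure"
  have rv: "random_vector (C \<union> B) X \<in> measurable M ?N" using d by (rule distributed_measurable)
  define G where "G = (\<lambda>S. \<integral>\<^sup>+x. ennreal (gauss_kernel C 1 A x) * indicator S x \<partial>?NC)"
  define H where "H = (\<lambda>T. \<integral>\<^sup>+x. ennreal (gauss_kernel B 1 A x) * indicator T x \<partial>?NB)"
  have eq: "emeasure M {\<omega>\<in>space M. random_vector C X \<omega> \<in> S \<and> random_vector B X \<omega> \<in> T} = ennreal c * (G S * H T)"
    if S: "S \<in> sets ?NC" and T: "T \<in> sets ?NB" for S T
  proof -
    let ?R = "((\<lambda>x. restrict x C) -` S \<inter> space ?N) \<inter> ((\<lambda>x. restrict x B) -` T \<inter> space ?N)"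
    have R: "?R \<in> sets ?N"
      by (intro sets.Int measurable_sets[OF measurable_restrict_subset S] measurable_sets[OF measurable_restrict_subset T]) auto
    have "{\<omega>\<in>space M. random_vector C X \<omega> \<in> S \<and> random_vector B X \<omega> \<in> T} = random_vector (C \<union> B) X -` ?R \<inter> space M"
      using measurable_space[OF rv] by (auto simp: restrict_random_vector)
    then have "emeasure M {\<omega>\<in>space M. random_vector C X \<omega> \<in> S \<and> random_vector B X \<omega> \<in> T}
       = (\<integral>\<^sup>+x. ennreal (gauss_kernel (C \<union> B) c A x) * indicator ?R x \<partial>?N)"
      using distributed_emeasure[OF d R] by simp
    also have "\<dots> = (\<integral>\<^sup>+x. \<integral>\<^sup>+y. ennreal (gauss_kernel (C \<union> B) c A (merge C B (x, y))) * indicator ?R (merge C B (x, y)) \<partial>?NB \<partial>?NC)"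
      using fin disj R measurable_gauss_kernel[of "C \<union> B" "C \<union> B" c A]
      by (intro lborel_prod.product_nn_integral_fold) auto
    also have "\<dots> = (\<integral>\<^sup>+x. \<integral>\<^sup>+y. (ennreal c * (ennreal (gauss_kernel C 1 A x) * indicator S x)) *
          (ennreal (gauss_kernel B 1 A y) * indicator T y) \<partial>?NB \<partial>?NC)"
    proof (intro nn_integral_cong)
      fix x y assume x: "x \<in> space ?NC" and y: "y \<in> space ?NB"
      have "merge C B (x, y) \<in> space ?N" using x y by (auto simp: space_PiM PiE_def merge_def extensional_def)
      moreover have "restrict (merge C B (x, y)) C = x" "restrict (merge C B (x, y)) B = y"
        using x y disj by (auto simp: space_PiM PiE_def extensional_def)
      ultimately have i: "indicator ?R (merge C B (x, y)) = (indicator S x * indicator T y :: ennreal)"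
        by (auto simp: indicator_def)
      have "gauss_kernel (C \<union> B) c A (merge C B (x, y)) = c * (gauss_kernel C 1 A x * gauss_kernel B 1 A y)"
        using pair_form_merge[OF disj fin, where A=A and x=x and y=y] cross
        by (simp add: gauss_kernel_def exp_add[symmetric] add_divide_distrib)
      then have "ennreal (gauss_kernel (C \<union> B) c A (merge C B (x, y)))
          = ennreal c * (ennreal (gauss_kernel C 1 A x) * ennreal (gauss_kernel B 1 A y))"
        using c by (simp add: gauss_kernel_def ennreal_mult')
      then show "ennreal (gauss_kernel (C \<union> B) c A (merge C B (x, y))) * indicator ?R (merge C B (x, y))
         = (ennreal c * (ennreal (gauss_kernel C 1 A x) * indicator S x)) * (ennreal (gauss_kernel B 1 A y) * indicator T y)"
        by (simp add: i mult_ac)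
    qed
    also have "\<dots> = (\<integral>\<^sup>+x. (ennreal c * (ennreal (gauss_kernel C 1 A x) * indicator S x)) * H T \<partial>?NC)"
      unfolding H_def using measurable_gauss_kernel[OF fin(2) order.refl, of 1 A] T
      by (intro nn_integral_cong nn_integral_cmult) auto
    also have "\<dots> = ennreal c * G S * H T"
      unfolding G_def using measurable_gauss_kernel[OF fin(1) order.refl, of 1 A] S
      by (subst nn_integral_multc) (auto simp: nn_integral_cmult)
    finally show ?thesis by (simp add: mult.assoc)
  qed
  have S': "S \<in> sets ?NC" and T': "T \<in> sets ?NB" using S T by (simp_all only: sets_PiM_lborel)
  have rvC: "random_vector C X \<omega> \<in> space ?NC" and rvB: "random_vector B X \<omega> \<in> space ?NB" for \<omega>
    by (auto simp: random_vector_def space_PiM)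
  have 1: "ennreal c * (G (space ?NC) * H (space ?NB)) = 1"
    using eq[of "space ?NC" "space ?NB"] rvC rvB by (simp add: emeasure_space_1)
  have "emeasure M {\<omega>\<in>space M. random_vector C X \<omega> \<in> S \<and> random_vector B X \<omega> \<in> T}
     = ennreal c * (G S * H T) * (ennreal c * (G (space ?NC) * H (space ?NB)))"
    using eq[OF S' T'] 1 by simp
  also have "\<dots> = (ennreal c * (G S * H (space ?NB))) * (ennreal c * (G (space ?NC) * H T))"
    by (simp add: mult_ac)
  also have "\<dots> = emeasure M {\<omega>\<in>space M. random_vector C X \<omega> \<in> S} * emeasure M {\<omega>\<in>space M. random_vector B X \<omega> \<in> T}"
    using eq[OF S' sets.top] eq[OF sets.top T'] rvC rvB by simp
  finally show ?thesis by (simp add: emeasure_eq_measure ennreal_mult[symmetric])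
qed

section \<open>Conditional independence and cross terms\<close>

text \<open>For the product density \<open>G x * W y\<close> the two sides would be equal. The factor \<open>exp (\<beta> * (x * y))\<close> increases the
masses of \<open>U\<^sub>1 \<times> V\<^sub>1\<close> and \<open>U\<^sub>2 \<times> V\<^sub>2\<close> and decreases those of the other two rectangles.\<close>

lemma cross_term_quadrants:
  fixes G W :: "real \<Rightarrow> real"
  assumes G[measurable]: "G \<in> borel_measurable borel" and W[measurable]: "W \<in> borel_measurable borel"
    and Gpos: "\<And>x. 0 < G x" and Wpos: "\<And>y. 0 < W y"
    and sets[measurable]: "U\<^sub>1 \<in> sets borel" "U\<^sub>2 \<in> sets borel" "V\<^sub>1 \<in> sets borel" "V\<^sub>2 \<in> sets borel"
    and pos: "emeasure lborel U\<^sub>1 \<noteq> 0" "emeasure lborel U\<^sub>2 \<noteq> 0" "emeasure lborel V\<^sub>1 \<noteq> 0" "emeasure lborel V\<^sub>2 \<noteq> 0"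
    and same: "\<And>x y. x \<in> U\<^sub>1 \<Longrightarrow> y \<in> V\<^sub>1 \<Longrightarrow> 0 < \<beta> * (x * y)" "\<And>x y. x \<in> U\<^sub>2 \<Longrightarrow> y \<in> V\<^sub>2 \<Longrightarrow> 0 < \<beta> * (x * y)"
    and diff: "\<And>x y. x \<in> U\<^sub>1 \<Longrightarrow> y \<in> V\<^sub>2 \<Longrightarrow> \<beta> * (x * y) < 0" "\<And>x y. x \<in> U\<^sub>2 \<Longrightarrow> y \<in> V\<^sub>1 \<Longrightarrow> \<beta> * (x * y) < 0"
  defines "H \<equiv> \<lambda>U V. \<integral>\<^sup>+y. \<integral>\<^sup>+x. ennreal (G x * W y * exp (\<beta> * (x * y))) * (indicator U x * indicator V y) \<partial>lborel \<partial>lborel"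
  assumes finite: "H U\<^sub>1 V\<^sub>1 \<noteq> \<infinity>" "H U\<^sub>2 V\<^sub>2 \<noteq> \<infinity>"
  shows "H U\<^sub>1 V\<^sub>2 * H U\<^sub>2 V\<^sub>1 < H U\<^sub>1 V\<^sub>1 * H U\<^sub>2 V\<^sub>2"
proof -
  let ?P = "lborel \<Otimes>\<^sub>M lborel :: (real \<times> real) measure"
  define f where "f = (\<lambda>U V (z :: real \<times> real). ennreal (G (snd z) * W (fst z) * exp (\<beta> * (snd z * fst z))) * (indicator U (snd z) * indicator V (fst z)))"
  define f0 where "f0 = (\<lambda>U V (z :: real \<times> real). ennreal (G (snd z) * W (fst z)) * (indicator U (snd z) * indicator V (fst z)))"
  \<comment> \<open>\<open>f0\<close> and \<open>H0\<close> are \<open>f\<close> and \<open>H\<close> without the interaction factor\<close>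
  define H0 where "H0 = (\<lambda>U V. \<integral>\<^sup>+z. f0 U V z \<partial>?P)"
  define g where "g = (\<lambda>U. \<integral>\<^sup>+x. ennreal (G x) * indicator U x \<partial>lborel)"
  define w where "w = (\<lambda>V. \<integral>\<^sup>+x. ennreal (W x) * indicator V x \<partial>lborel)"
  have fm: "f U V \<in> borel_measurable ?P" and f0m: "f0 U V \<in> borel_measurable ?P"
    if [measurable]: "U \<in> sets borel" "V \<in> sets borel" for U V
    unfolding f_def f0_def by measurable
  have H: "H U V = (\<integral>\<^sup>+z. f U V z \<partial>?P)" if "U \<in> sets borel" "V \<in> sets borel" for U V
    using lborel.nn_integral_fst[OF fm[OF that]] by (simp add: H_def f_def)
  have H0: "H0 U V = g U * w V" if UV[measurable]: "U \<in> sets borel" "V \<in> sets borel" for U V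
  proof -
    have "H0 U V = (\<integral>\<^sup>+y. \<integral>\<^sup>+x. (ennreal (G x) * indicator U x) * (ennreal (W y) * indicator V y) \<partial>lborel \<partial>lborel)"
      unfolding H0_def lborel.nn_integral_fst[OF f0m[OF that], symmetric]
      using Gpos Wpos by (intro nn_integral_cong) (simp add: f0_def ennreal_mult less_imp_le mult_ac)
    also have "\<dots> = (\<integral>\<^sup>+y. g U * (ennreal (W y) * indicator V y) \<partial>lborel)"
      unfolding g_def by (intro nn_integral_cong nn_integral_multc) measurable
    also have "\<dots> = g U * w V" unfolding w_def by (rule nn_integral_cmult) measurable
    finally show ?thesis .
  qed
  have not_AE: "\<not> (AE z in ?P. z \<notin> V \<times> U)"
    if [measurable]: "U \<in> sets borel" "V \<in> sets borel" and "emeasure lborel U \<noteq> 0" "emeasure lborel V \<noteq> 0" for U V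
  proof
    assume "AE z in ?P. z \<notin> V \<times> U"
    moreover have VU: "V \<times> U \<in> sets ?P" using that by (intro pair_measureI) simp_all
    moreover have "{z \<in> space ?P. \<not> z \<notin> V \<times> U} = V \<times> U" by (auto simp: space_pair_measure)
    ultimately have "V \<times> U \<in> null_sets ?P" using AE_iff_null[of ?P "\<lambda>z. z \<notin> V \<times> U"] by metis
    then have "emeasure lborel V * emeasure lborel U = 0"
      using lborel.emeasure_pair_measure_Times[of V lborel U] that(1,2) by (simp add: null_sets_def)
    then show False using that(3,4) by simp
  qed
  have up: "f0 U V z \<le> f U V z" if "\<And>x y. x \<in> U \<Longrightarrow> y \<in> V \<Longrightarrow> 0 < \<beta> * (x * y)" for U V z
  proof (cases "snd z \<in> U \<and> fst z \<in> V")
    case True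
    then have "1 \<le> exp (\<beta> * (snd z * fst z))" using that[of "snd z" "fst z"] by simp
    then have "(G (snd z) * W (fst z)) * 1 \<le> (G (snd z) * W (fst z)) * exp (\<beta> * (snd z * fst z))"
      using Gpos[of "snd z"] Wpos[of "fst z"] by (intro mult_left_mono) auto
    then show ?thesis using True by (simp add: f_def f0_def ennreal_leI)
  qed (auto simp: f_def f0_def)
  have down: "f U V z \<le> f0 U V z" if "\<And>x y. x \<in> U \<Longrightarrow> y \<in> V \<Longrightarrow> \<beta> * (x * y) < 0" for U V z
  proof (cases "snd z \<in> U \<and> fst z \<in> V")
    case True
    then have "exp (\<beta> * (snd z * fst z)) \<le> 1" using that[of "snd z" "fst z"] by simp
    then have "(G (snd z) * W (fst z)) * exp (\<beta> * (snd z * fst z)) \<le> (G (snd z) * W (fst z)) * 1"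
      using Gpos[of "snd z"] Wpos[of "fst z"] by (intro mult_left_mono) auto
    then show ?thesis using True by (simp add: f_def f0_def ennreal_leI)
  qed (auto simp: f_def f0_def)
  have le22: "H0 U\<^sub>2 V\<^sub>2 \<le> H U\<^sub>2 V\<^sub>2" and le11: "H0 U\<^sub>1 V\<^sub>1 \<le> H U\<^sub>1 V\<^sub>1"
    unfolding H0_def H[OF sets(2,4)] H[OF sets(1,3)] by (intro nn_integral_mono up same; assumption)+
  have le12: "H U\<^sub>1 V\<^sub>2 \<le> H0 U\<^sub>1 V\<^sub>2" and le21: "H U\<^sub>2 V\<^sub>1 \<le> H0 U\<^sub>2 V\<^sub>1"
    unfolding H0_def H[OF sets(1,4)] H[OF sets(2,3)] by (intro nn_integral_mono down diff; assumption)+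
  have "H0 U\<^sub>1 V\<^sub>1 < H U\<^sub>1 V\<^sub>1"
    unfolding H0_def H[OF sets(1,3)]
  proof (rule nn_integral_less[OF f0m fm])
    show "(\<integral>\<^sup>+z. f0 U\<^sub>1 V\<^sub>1 z \<partial>?P) \<noteq> \<infinity>" using le11 finite(1) unfolding H0_def by (auto simp: top_unique)
    show "AE z in ?P. f0 U\<^sub>1 V\<^sub>1 z \<le> f U\<^sub>1 V\<^sub>1 z" by (intro AE_I2 up same(1))
    have "z \<notin> V\<^sub>1 \<times> U\<^sub>1" if "f U\<^sub>1 V\<^sub>1 z \<le> f0 U\<^sub>1 V\<^sub>1 z" for z
    proof
      assume z: "z \<in> V\<^sub>1 \<times> U\<^sub>1"
      then have "1 < exp (\<beta> * (snd z * fst z))" using same(1)[of "snd z" "fst z"] by auto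
      moreover have "G (snd z) * W (fst z) * exp (\<beta> * (snd z * fst z)) \<le> G (snd z) * W (fst z)"
        using that z Gpos[of "snd z"] Wpos[of "fst z"]
        by (auto simp: f_def f0_def ennreal_le_iff less_imp_le mem_Times_iff)
      moreover have "0 < G (snd z) * W (fst z)" using Gpos Wpos by simp
      ultimately show False by (simp add: mult_le_cancel_left2)
    qed
    then show "\<not> (AE z in ?P. f U\<^sub>1 V\<^sub>1 z \<le> f0 U\<^sub>1 V\<^sub>1 z)"
      using not_AE[OF sets(1,3) pos(1,3)] by (metis (mono_tags, lifting) eventually_mono)
  qed (rule sets)+
  moreover have "H0 U\<^sub>2 V\<^sub>2 \<noteq> 0"
  proof
    assume "H0 U\<^sub>2 V\<^sub>2 = 0"
    then have "AE z in ?P. f0 U\<^sub>2 V\<^sub>2 z = 0"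
      unfolding H0_def by (subst (asm) nn_integral_0_iff_AE) (auto intro: f0m sets)
    moreover have "z \<notin> V\<^sub>2 \<times> U\<^sub>2" if "f0 U\<^sub>2 V\<^sub>2 z = 0" for z
      using that Gpos[of "snd z"] Wpos[of "fst z"] by (auto simp: f0_def)
    ultimately show False using not_AE[OF sets(2,4) pos(2,4)] by (metis (mono_tags, lifting) eventually_mono)
  qed
  moreover have "H0 U\<^sub>2 V\<^sub>2 \<noteq> \<infinity>" using le22 finite(2) by (auto simp: top_unique)
  ultimately have "H0 U\<^sub>1 V\<^sub>1 * H0 U\<^sub>2 V\<^sub>2 < H U\<^sub>1 V\<^sub>1 * H0 U\<^sub>2 V\<^sub>2"
    by (intro ennreal_mult_strict_right_mono) (auto simp: less_top zero_less_iff_neq_zero)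
  also have "\<dots> \<le> H U\<^sub>1 V\<^sub>1 * H U\<^sub>2 V\<^sub>2" by (intro mult_left_mono le22) simp
  finally have "H0 U\<^sub>1 V\<^sub>1 * H0 U\<^sub>2 V\<^sub>2 < H U\<^sub>1 V\<^sub>1 * H U\<^sub>2 V\<^sub>2" .
  moreover have "H U\<^sub>1 V\<^sub>2 * H U\<^sub>2 V\<^sub>1 \<le> H0 U\<^sub>1 V\<^sub>2 * H0 U\<^sub>2 V\<^sub>1" by (intro mult_mono le12 le21) auto
  moreover have "H0 U\<^sub>1 V\<^sub>2 * H0 U\<^sub>2 V\<^sub>1 = H0 U\<^sub>1 V\<^sub>1 * H0 U\<^sub>2 V\<^sub>2"
    using sets by (simp add: H0 mult_ac)
  ultimately show ?thesis by simp
qed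

text \<open>The mass that the joint density assigns to \<open>U\<close> in coordinate \<open>a\<close> and \<open>V\<close> in coordinate \<open>b\<close> when the
coordinates in \<open>R\<close> are frozen at \<open>z\<close>; divided by its value for \<open>U = V = UNIV\<close> it is a conditional
probability.\<close>

definition slice_mass ::
    "nat \<Rightarrow> nat \<Rightarrow> nat set \<Rightarrow> real \<Rightarrow> (nat \<Rightarrow> nat \<Rightarrow> real) \<Rightarrow> real set \<Rightarrow> real set \<Rightarrow> (nat \<Rightarrow> real) \<Rightarrow> ennreal" where
  "slice_mass a b R c A U V z = (\<integral>\<^sup>+y. \<integral>\<^sup>+x. ennreal (gauss_kernel (insert a (insert b R)) c A (z(b := y, a := x)))
     * (indicator U x * indicator V y) \<partial>lborel \<partial>lborel)"

text \<open>Only the signs of the two coordinates are used: if these are independent in the slice at \<open>z\<close>, the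
two-by-two table of their masses has determinant zero. A cross term makes the determinant
nonzero, by \<open>cross_term_quadrants\<close>.\<close>

lemma slice_mass_no_product:
  assumes fin: "finite R" and ab: "a \<noteq> b" "a \<notin> R" "b \<notin> R" and c: "0 < c"
    and fm: "slice_mass a b R c A UNIV UNIV z \<noteq> \<infinity>"
    and prod: "slice_mass a b R c A {0<..} {0<..} z * slice_mass a b R c A {..<0} {..<0} z
             = slice_mass a b R c A {0<..} {..<0} z * slice_mass a b R c A {..<0} {0<..} z"
  shows "A a b + A b a = 0"
proof (rule ccontr)
  assume nz: "A a b + A b a \<noteq> 0"
  define \<beta> where "\<beta> = - (A a b + A b a) / 2"
  define la where "la = (\<Sum>j\<in>R. (A a j + A j a) * z j)"
  define lb where "lb = (\<Sum>j\<in>R. (A b j + A j b) * z j)"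
  define G where "G = (\<lambda>x. exp (- (A a a * x\<^sup>2 + la * x) / 2))"
  define W where "W = (\<lambda>y. c * exp (- (A b b * y\<^sup>2 + lb * y + pair_form R A z) / 2))"
  have kernel: "gauss_kernel (insert a (insert b R)) c A (z(b := y, a := x)) = G x * W y * exp (\<beta> * (x * y))" for x y
  proof -
    have "(\<Sum>j\<in>insert b R. (A a j + A j a) * (z(b := y)) j) = (A a b + A b a) * y + la"
    proof -
      have "(\<Sum>j\<in>R. (A a j + A j a) * (z(b := y)) j) = la"
        unfolding la_def using ab by (intro sum.cong) auto
      then show ?thesis using fin ab by simp
    qed
    then have "pair_form (insert a (insert b R)) A (z(b := y, a := x))
       = A a a * x\<^sup>2 + ((A a b + A b a) * y + la) * x + (A b b * y\<^sup>2 + lb * y + pair_form R A z)"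
      using fin ab by (simp add: pair_form_insert lb_def)
    also have "- \<dots> / 2 = - (A a a * x\<^sup>2 + la * x) / 2 + - (A b b * y\<^sup>2 + lb * y + pair_form R A z) / 2 + \<beta> * (x * y)"
      by (simp add: \<beta>_def field_simps)
    finally have e: "exp (- pair_form (insert a (insert b R)) A (z(b := y, a := x)) / 2)
        = exp (- (A a a * x\<^sup>2 + la * x) / 2) * exp (- (A b b * y\<^sup>2 + lb * y + pair_form R A z) / 2) * exp (\<beta> * (x * y))"
      by (simp only: exp_add)
    show ?thesis unfolding gauss_kernel_def e G_def W_def by (simp only: mult_ac)
  qed
  have Gm: "G \<in> borel_measurable borel" and Wm: "W \<in> borel_measurable borel"
    unfolding G_def W_def by measurable
  have pos: "0 < G x" "0 < W y" for x y using c by (simp_all add: G_def W_def)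
  have hfin: "slice_mass a b R c A U V z \<noteq> \<infinity>" for U V
  proof -
    have "slice_mass a b R c A U V z \<le> slice_mass a b R c A UNIV UNIV z"
      unfolding slice_mass_def by (intro nn_integral_mono mult_left_mono) (auto simp: indicator_def)
    with fm show ?thesis by (auto simp: top_unique)
  qed
  have em: "emeasure lborel {0::real<..} \<noteq> 0" "emeasure lborel {..<0::real} \<noteq> 0"
  proof -
    have "emeasure lborel {0<..<1::real} \<le> emeasure lborel {0::real<..}" by (intro emeasure_mono) auto
    then show "emeasure lborel {0::real<..} \<noteq> 0" by auto
    have "emeasure lborel {-1<..<0::real} \<le> emeasure lborel {..<0::real}" by (intro emeasure_mono) auto
    then show "emeasure lborel {..<0::real} \<noteq> 0" by auto
  qed
  have cross: "slice_mass a b R c A U\<^sub>1 V\<^sub>2 z * slice_mass a b R c A U\<^sub>2 V\<^sub>1 z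
      < slice_mass a b R c A U\<^sub>1 V\<^sub>1 z * slice_mass a b R c A U\<^sub>2 V\<^sub>2 z"
    if "U\<^sub>1 = {0<..}" "U\<^sub>2 = {..<0}" "V\<^sub>1 = (if 0 < \<beta> then {0<..} else {..<0})" "V\<^sub>2 = (if 0 < \<beta> then {..<0} else {0<..})"
    for U\<^sub>1 U\<^sub>2 V\<^sub>1 V\<^sub>2
  proof -
    have \<beta>: "\<beta> < 0" if "\<not> 0 < \<beta>" using nz that by (simp add: \<beta>_def)
    have signs: "0 < \<beta> * (x * y)" if "x \<in> U\<^sub>1" "y \<in> V\<^sub>1" for x y
      using that \<beta> \<open>U\<^sub>1 = _\<close> \<open>V\<^sub>1 = _\<close>
      by (cases "0 < \<beta>") (auto simp: zero_less_mult_iff mult_less_0_iff)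
    have signs2: "0 < \<beta> * (x * y)" if "x \<in> U\<^sub>2" "y \<in> V\<^sub>2" for x y
      using that \<beta> \<open>U\<^sub>2 = _\<close> \<open>V\<^sub>2 = _\<close>
      by (cases "0 < \<beta>") (auto simp: zero_less_mult_iff mult_less_0_iff)
    have signs3: "\<beta> * (x * y) < 0" if "x \<in> U\<^sub>1" "y \<in> V\<^sub>2" for x y
      using that \<beta> \<open>U\<^sub>1 = _\<close> \<open>V\<^sub>2 = _\<close>
      by (cases "0 < \<beta>") (auto simp: zero_less_mult_iff mult_less_0_iff)
    have signs4: "\<beta> * (x * y) < 0" if "x \<in> U\<^sub>2" "y \<in> V\<^sub>1" for x y
      using that \<beta> \<open>U\<^sub>2 = _\<close> \<open>V\<^sub>1 = _\<close>
      by (cases "0 < \<beta>") (auto simp: zero_less_mult_iff mult_less_0_iff)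
    show ?thesis
      unfolding slice_mass_def kernel
    proof (rule cross_term_quadrants[OF Gm Wm pos])
      show "U\<^sub>1 \<in> sets borel" "U\<^sub>2 \<in> sets borel" "V\<^sub>1 \<in> sets borel" "V\<^sub>2 \<in> sets borel"
        using that by auto
      show "emeasure lborel U\<^sub>1 \<noteq> 0" "emeasure lborel U\<^sub>2 \<noteq> 0" "emeasure lborel V\<^sub>1 \<noteq> 0" "emeasure lborel V\<^sub>2 \<noteq> 0"
        using that em by auto
    qed (use signs signs2 signs3 signs4 hfin[unfolded slice_mass_def kernel] in blast)+
  qed
  show False using cross[OF refl refl refl refl] prod by (cases "0 < \<beta>") auto
qed

lemma measurable_two_updates:
  "(\<lambda>w. (fst (fst w))(b := snd (fst w), a := snd w)) \<in> measurable (((\<Pi>\<^sub>M i\<in>R. lborel) \<Otimes>\<^sub>M lborel) \<Otimes>\<^sub>M lborel)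
    (\<Pi>\<^sub>M i\<in>insert a (insert b R). lborel :: real measure)"
proof -
  let ?N = "\<Pi>\<^sub>M i\<in>R. lborel :: real measure" and ?Nb = "\<Pi>\<^sub>M i\<in>insert b R. lborel :: real measure"
  have "(\<lambda>v. (fst v)(b := snd v)) \<in> measurable (?N \<Otimes>\<^sub>M lborel) ?Nb"
    using measurable_add_dim[of b R "\<lambda>_. lborel :: real measure"] by (simp only: case_prod_beta')
  then have "(\<lambda>w. ((fst (fst w))(b := snd (fst w)), snd w)) \<in> measurable ((?N \<Otimes>\<^sub>M lborel) \<Otimes>\<^sub>M lborel) (?Nb \<Otimes>\<^sub>M lborel)"
    by (intro measurable_Pair measurable_compose[OF measurable_fst] measurable_snd)
  from measurable_compose[OF this measurable_add_dim[of a "insert b R" "\<lambda>_. lborel :: real measure"]]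
  show ?thesis by (simp only: case_prod_beta' fst_conv snd_conv)
qed

lemma measurable_slice_mass:
  assumes fin: "finite R" and UV: "U \<in> sets borel" "V \<in> sets borel"
  shows "slice_mass a b R c A U V \<in> borel_measurable (\<Pi>\<^sub>M i\<in>R. lborel)"
proof -
  let ?I = "insert a (insert b R)" and ?N = "\<Pi>\<^sub>M i\<in>R. lborel :: real measure"
  have "gauss_kernel ?I c A \<in> borel_measurable (\<Pi>\<^sub>M i\<in>?I. lborel)"
    by (rule measurable_gauss_kernel) (use fin in auto)
  then have k: "(\<lambda>w. ennreal (gauss_kernel ?I c A ((fst (fst w))(b := snd (fst w), a := snd w))))
     \<in> borel_measurable ((?N \<Otimes>\<^sub>M lborel) \<Otimes>\<^sub>M lborel)"
    by (intro measurable_compose[OF _ measurable_ennreal] measurable_compose[OF measurable_two_updates])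
  have "(\<lambda>w. \<integral>\<^sup>+x. ennreal (gauss_kernel ?I c A ((fst w)(b := snd w, a := x)))
     * (indicator U x * indicator V (snd w)) \<partial>lborel) \<in> borel_measurable (?N \<Otimes>\<^sub>M lborel)"
  proof (rule lborel.borel_measurable_nn_integral)
    have "(\<lambda>w. indicator U (snd w) * indicator V (snd (fst w)) :: ennreal) \<in> borel_measurable ((?N \<Otimes>\<^sub>M lborel) \<Otimes>\<^sub>M lborel)"
      using UV by measurable
    from borel_measurable_times_ennreal[OF k this]
    show "(\<lambda>(w, x). ennreal (gauss_kernel ?I c A ((fst w)(b := snd w, a := x))) * (indicator U x * indicator V (snd w)))
      \<in> borel_measurable ((?N \<Otimes>\<^sub>M lborel) \<Otimes>\<^sub>M lborel)" by (simp only: case_prod_beta')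
  qed
  then show ?thesis unfolding slice_mass_def
    by (intro lborel.borel_measurable_nn_integral) (simp only: case_prod_beta' fst_conv snd_conv)
qed

lemma gaussian_vector_slices:
  assumes M: "prob_space M" and g: "gaussian_vector M (insert a (insert b R)) X c A"
    and ab: "a \<noteq> b" "a \<notin> R" "b \<notin> R"
    and D: "D \<in> sets (\<Pi>\<^sub>M i\<in>R. lborel)" and UV[measurable]: "U \<in> sets borel" "V \<in> sets borel"
  shows "emeasure M {\<omega>\<in>space M. X a \<omega> \<in> U \<and> X b \<omega> \<in> V \<and> random_vector R X \<omega> \<in> D}
    = (\<integral>\<^sup>+z. slice_mass a b R c A U V z * indicator D z \<partial>(\<Pi>\<^sub>M i\<in>R. lborel))"
proof -
  let ?I = "insert a (insert b R)"
  let ?N = "\<Pi>\<^sub>M i\<in>?I. lborel :: real measure" and ?Nb = "\<Pi>\<^sub>M i\<in>insert b R. lborel :: real measure"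
  let ?k = "\<lambda>x. ennreal (gauss_kernel ?I c A x)"
  have fin: "finite R" and d: "distributed M ?N (random_vector ?I X) ?k"
    using g by (auto simp: gaussian_vector_def)
  have rv: "random_vector ?I X \<in> measurable M ?N" using d by (rule distributed_measurable)
  have km: "?k \<in> borel_measurable ?N" using measurable_gauss_kernel[of ?I ?I c A] fin by simp
  let ?S = "((\<lambda>x. x a) -` U \<inter> space ?N) \<inter> ((\<lambda>x. x b) -` V \<inter> space ?N) \<inter> ((\<lambda>x. restrict x R) -` D \<inter> space ?N)"
  have S: "?S \<in> sets ?N"
    by (intro sets.Int measurable_sets[OF measurable_component_singleton] measurable_sets[OF measurable_restrict_subset D]) (use UV in auto)
  have "{\<omega>\<in>space M. X a \<omega> \<in> U \<and> X b \<omega> \<in> V \<and> random_vector R X \<omega> \<in> D} = random_vector ?I X -` ?S \<inter> space M"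
    using measurable_space[OF rv] restrict_random_vector[of R ?I X] by (auto simp: random_vector_def subset_insertI2)
  then have "emeasure M {\<omega>\<in>space M. X a \<omega> \<in> U \<and> X b \<omega> \<in> V \<and> random_vector R X \<omega> \<in> D}
      = (\<integral>\<^sup>+x. ?k x * indicator ?S x \<partial>?N)"
    using distributed_emeasure[OF d S] by simp
  also have "\<dots> = (\<integral>\<^sup>+w. \<integral>\<^sup>+x. ?k (w(a := x)) * indicator ?S (w(a := x)) \<partial>lborel \<partial>?Nb)"
    using fin ab S km by (intro lborel_prod.product_nn_integral_insert) auto
  also have "\<dots> = (\<integral>\<^sup>+z. \<integral>\<^sup>+y. \<integral>\<^sup>+x. ?k (z(b := y, a := x)) * indicator ?S (z(b := y, a := x)) \<partial>lborel \<partial>lborel \<partial>(\<Pi>\<^sub>M i\<in>R. lborel))"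
  proof (rule lborel_prod.product_nn_integral_insert)
    have "(\<lambda>(w, x). w(a := x)) \<in> measurable (?Nb \<Otimes>\<^sub>M lborel) ?N"
      by (rule measurable_add_dim)
    from measurable_compose[OF this borel_measurable_times_ennreal[OF km borel_measurable_indicator[OF S]]]
    show "(\<lambda>w. \<integral>\<^sup>+x. ?k (w(a := x)) * indicator ?S (w(a := x)) \<partial>lborel) \<in> borel_measurable ?Nb"
      by (intro lborel.borel_measurable_nn_integral) (simp add: case_prod_beta')
  qed (use fin ab in auto)
  also have "\<dots> = (\<integral>\<^sup>+z. slice_mass a b R c A U V z * indicator D z \<partial>(\<Pi>\<^sub>M i\<in>R. lborel))"
  proof (intro nn_integral_cong)
    fix z assume z: "z \<in> space (\<Pi>\<^sub>M i\<in>R. lborel :: real measure)"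
    have i: "indicator ?S (z(b := y, a := x)) = (indicator U x * indicator V y * indicator D z :: ennreal)" for x y
    proof -
      have "restrict (z(b := y, a := x)) R = z"
        using z ab by (auto simp: space_PiM PiE_def extensional_def restrict_def fun_eq_iff)
      moreover have "z(b := y, a := x) \<in> space ?N" using z by (auto simp: space_PiM PiE_def extensional_def)
      ultimately show ?thesis using ab by (auto simp: indicator_def)
    qed
    show "(\<integral>\<^sup>+y. \<integral>\<^sup>+x. ?k (z(b := y, a := x)) * indicator ?S (z(b := y, a := x)) \<partial>lborel \<partial>lborel)
        = slice_mass a b R c A U V z * indicator D z"
      by (cases "z \<in> D") (simp_all add: i slice_mass_def)
  qed
  finally show ?thesis .
qed

text \<open>Given \<open>X k\<close> for \<open>k \<in> R\<close>, the events \<open>X a \<in> U\<close> and \<open>X b \<in> V\<close> have the joint conditional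
probability \<open>h U V (Z \<omega>) / m (Z \<omega>)\<close>. Conditional independence of the four combinations of signs makes
the table of these masses singular for almost every \<open>\<omega>\<close>, and one such \<open>\<omega>\<close> suffices.\<close>

lemma cond_indep_imp_no_cross_term:
  assumes M: "prob_space M" and g: "gaussian_vector M (insert a (insert b R)) X c A"
    and ab: "a \<noteq> b" "a \<notin> R" "b \<notin> R"
    and ci: "cond_indep M (generated_by M X R) (X a) (X b)"
  shows "A a b + A b a = 0"
proof -
  interpret prob_space M by fact
  let ?I = "insert a (insert b R)"
  let ?N = "\<Pi>\<^sub>M i\<in>R. lborel :: real measure"
  define F where "F = generated_by M X R"
  define Z where "Z = random_vector R X"
  define h where "h = slice_mass a b R c A"
  define m where "m = h UNIV UNIV"
  have fin: "finite R" and c: "0 < c" using g by (auto simp: gaussian_vector_def)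
  have rv: "random_vector ?I X \<in> measurable M (\<Pi>\<^sub>M i\<in>?I. lborel)"
    using g by (auto simp: gaussian_vector_def dest: distributed_measurable)
  have Z[measurable]: "Z \<in> measurable M ?N"
    unfolding Z_def using measurable_compose[OF rv measurable_restrict_subset[of R]]
    by (simp add: restrict_random_vector subset_insertI2)
  have X: "X i \<in> borel_measurable M" if "i \<in> ?I" for i
    using measurable_compose[OF rv measurable_component_singleton[OF that]] that by (simp add: random_vector_def)
  have hm[measurable]: "h U V \<in> borel_measurable ?N" if "U \<in> sets borel" "V \<in> sets borel" for U V
    unfolding h_def by (rule measurable_slice_mass[OF fin that])
  have mm[measurable]: "m \<in> borel_measurable ?N" unfolding m_def by (rule hm) auto
  have slices: "emeasure M {\<omega>\<in>space M. X a \<omega> \<in> U \<and> X b \<omega> \<in> V \<and> Z \<omega> \<in> D} = (\<integral>\<^sup>+z. h U V z * indicator D z \<partial>?N)"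
    if "D \<in> sets ?N" "U \<in> sets borel" "V \<in> sets borel" for D U V
    unfolding h_def Z_def by (rule gaussian_vector_slices[OF M g ab that])
  have sZ: "Z \<omega> \<in> space ?N" for \<omega> by (auto simp: Z_def random_vector_def space_PiM)
  have dZ: "distr M ?N Z = density ?N m"
  proof (rule measure_eqI)
    fix D assume "D \<in> sets (distr M ?N Z)"
    then have D: "D \<in> sets ?N" by simp
    have "Z -` D \<inter> space M = {\<omega>\<in>space M. X a \<omega> \<in> UNIV \<and> X b \<omega> \<in> UNIV \<and> Z \<omega> \<in> D}" by auto
    then show "emeasure (distr M ?N Z) D = emeasure (density ?N m) D"
      using slices[OF D, of UNIV UNIV] D by (simp add: emeasure_distr emeasure_density m_def)
  qed simp
  have intZ: "(\<integral>\<^sup>+\<omega>. f (Z \<omega>) \<partial>M) = (\<integral>\<^sup>+z. m z * f z \<partial>?N)" if "f \<in> borel_measurable ?N" for f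
    using nn_integral_distr[OF Z, of f] that nn_integral_density[OF mm that] unfolding dZ by simp
  have "(\<integral>\<^sup>+z. m z \<partial>?N) = 1" using intZ[of "\<lambda>_. 1"] by (simp add: emeasure_space_1)
  then have mfin: "AE z in ?N. m z \<noteq> \<infinity>" by (intro nn_integral_PInf_AE) auto
  have hle: "h U V z \<le> m z" for U V z
    unfolding h_def m_def slice_mass_def by (intro nn_integral_mono mult_left_mono) (auto simp: indicator_def)
  have dens: "AE z in distr M ?N Z. m z \<noteq> 0 \<and> m z \<noteq> \<infinity>"
    unfolding dZ using mfin by (subst AE_density) (auto elim!: eventually_mono)
  have mAE: "AE \<omega> in M. m (Z \<omega>) \<noteq> 0 \<and> m (Z \<omega>) \<noteq> \<infinity>"
    by (rule AE_distrD[OF Z dens])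
  have setsF: "sets F = {Z -` D \<inter> space M | D. D \<in> sets ?N}" and spaceF: "space F = space M"
  proof -
    have "F = vimage_algebra (space M) Z ?N"
      unfolding F_def generated_by_def Z_def by (rule vimage_algebra_cong) (auto simp: sets_PiM_lborel)
    then show "sets F = {Z -` D \<inter> space M | D. D \<in> sets ?N}" "space F = space M"
      using sZ by (auto simp: sets_vimage_algebra2)
  qed
  have ZF: "Z \<in> measurable F ?N"
    by (rule measurableI) (use sZ in \<open>auto simp: setsF spaceF\<close>)
  have sub: "subalgebra M F"
    unfolding subalgebra_def using measurable_sets[OF Z] by (auto simp: setsF spaceF)
  interpret F: finite_measure_subalgebra M F by unfold_locales (rule sub)
  define E where "E = (\<lambda>U V. {\<omega>\<in>space M. X a \<omega> \<in> U \<and> X b \<omega> \<in> V})"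
  have Em: "E U V \<in> sets M" if [measurable]: "U \<in> sets borel" "V \<in> sets borel" for U V
  proof -
    have [measurable]: "X a \<in> borel_measurable M" "X b \<in> borel_measurable M" using X by auto
    show ?thesis unfolding E_def by measurable
  qed
  have cp: "AE \<omega> in M. cond_prob_given M F (E U V) \<omega> = enn2real (h U V (Z \<omega>) / m (Z \<omega>))"
    if UV: "U \<in> sets borel" "V \<in> sets borel" for U V
  proof -
    have zero: "AE \<omega> in M. 0 = nn_cond_exp M F (\<lambda>\<omega>. 0) \<omega>"
      by (rule F.nn_cond_exp_F_meas) simp
    have neg: "(\<lambda>\<omega>. ennreal (- indicator (E U V) \<omega>)) = (\<lambda>\<omega>. 0)"
      by (auto simp: indicator_def fun_eq_iff ennreal_neg)
    have qm: "(\<lambda>z. h U V z / m z) \<in> borel_measurable ?N" using hm[OF UV] mm by measurable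
    have "AE \<omega> in M. h U V (Z \<omega>) / m (Z \<omega>) = nn_cond_exp M F (\<lambda>\<omega>. ennreal (indicator (E U V) \<omega>)) \<omega>"
    proof (rule F.nn_cond_exp_charact)
      fix B assume "B \<in> sets F"
      then obtain D where D[measurable]: "D \<in> sets ?N" and B: "B = Z -` D \<inter> space M" by (auto simp: setsF)
      have "B \<in> sets M" using B Z D by (auto intro: measurable_sets)
      have "(\<integral>\<^sup>+\<omega>\<in>B. ennreal (indicator (E U V) \<omega>) \<partial>M) = (\<integral>\<^sup>+\<omega>. indicator (E U V \<inter> B) \<omega> \<partial>M)"
        by (intro nn_integral_cong) (auto simp: indicator_def)
      also have "\<dots> = emeasure M (E U V \<inter> B)" using Em[OF UV] \<open>B \<in> sets M\<close> by simp
      also have "E U V \<inter> B = {\<omega>\<in>space M. X a \<omega> \<in> U \<and> X b \<omega> \<in> V \<and> Z \<omega> \<in> D}" by (auto simp: E_def B)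
      also have "emeasure M \<dots> = (\<integral>\<^sup>+z. h U V z * indicator D z \<partial>?N)" by (rule slices[OF D UV])
      also have "\<dots> = (\<integral>\<^sup>+z. m z * (h U V z / m z * indicator D z) \<partial>?N)"
      proof (rule nn_integral_cong_AE, use mfin in eventually_elim)
        case (elim z)
        have "m z * (h U V z / m z) = h U V z"
        proof (cases "m z = 0")
          case True then show ?thesis using hle[of U V z] by simp
        next
          case False
          then have "h U V z * m z / m z = h U V z" using elim by (intro ennreal_mult_divide_eq) auto
          then show ?thesis unfolding ennreal_times_divide by (subst mult.commute)
        qed
        then show ?case by (simp add: mult.assoc[symmetric])
      qed
      also have "\<dots> = (\<integral>\<^sup>+\<omega>. h U V (Z \<omega>) / m (Z \<omega>) * indicator D (Z \<omega>) \<partial>M)"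
        by (intro intZ[symmetric] borel_measurable_times_ennreal borel_measurable_indicator qm D)
      also have "\<dots> = (\<integral>\<^sup>+\<omega>\<in>B. h U V (Z \<omega>) / m (Z \<omega>) \<partial>M)"
        by (intro nn_integral_cong) (auto simp: B indicator_def)
      finally show "(\<integral>\<^sup>+\<omega>\<in>B. ennreal (indicator (E U V) \<omega>) \<partial>M) = (\<integral>\<^sup>+\<omega>\<in>B. h U V (Z \<omega>) / m (Z \<omega>) \<partial>M)" .
    next
      show "(\<lambda>\<omega>. ennreal (indicator (E U V) \<omega>)) \<in> borel_measurable M" using Em[OF UV] by measurable
      show "(\<lambda>\<omega>. h U V (Z \<omega>) / m (Z \<omega>)) \<in> borel_measurable F" by (rule measurable_compose[OF ZF qm])
    qed
    then show ?thesis using zero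
      unfolding cond_prob_given_def real_cond_exp_def neg by eventually_elim simp
  qed
  have indep: "AE \<omega> in M. enn2real (h U V (Z \<omega>) / m (Z \<omega>))
      = enn2real (h U UNIV (Z \<omega>) / m (Z \<omega>)) * enn2real (h UNIV V (Z \<omega>) / m (Z \<omega>))"
    if UV: "U \<in> sets borel" "V \<in> sets borel" for U V
  proof -
    have "AE \<omega> in M. cond_prob_given M F (E U V) \<omega> = cond_prob_given M F (E U UNIV) \<omega> * cond_prob_given M F (E UNIV V) \<omega>"
      using ci[unfolded cond_indep_def, folded F_def, rule_format, OF UV] by (simp add: E_def)
    moreover have "AE \<omega> in M. cond_prob_given M F (E U UNIV) \<omega> = enn2real (h U UNIV (Z \<omega>) / m (Z \<omega>))"
      "AE \<omega> in M. cond_prob_given M F (E UNIV V) \<omega> = enn2real (h UNIV V (Z \<omega>) / m (Z \<omega>))"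
      using UV by (intro cp; simp)+
    ultimately show ?thesis using cp[OF UV] by eventually_elim simp
  qed
  let ?P = "{0::real<..}" and ?Q = "{..<0::real}"
  have b: "?P \<in> sets borel" "?Q \<in> sets borel" by auto
  have "AE \<omega> in M. A a b + A b a = 0"
    using indep[OF b(1) b(1)] indep[OF b(1) b(2)] indep[OF b(2) b(1)] indep[OF b(2) b(2)] mAE
  proof eventually_elim
    case (elim \<omega>)
    define z where "z = Z \<omega>"
    define m' where "m' = enn2real (m z)"
    have fin_m: "m z \<noteq> \<infinity>" and m'0: "0 < m'"
      using elim(5) by (auto simp: z_def m'_def enn2real_positive_iff less_top zero_less_iff_neq_zero)
    have fin_h: "h U V z \<noteq> \<infinity>" for U V using hle[of U V z] fin_m by (auto simp: top_unique)
    have ratio: "enn2real (h U V z / m z) = enn2real (h U V z) / m'" for U V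
    proof -
      have "h U V z / m z = ennreal (enn2real (h U V z)) / ennreal m'"
        using fin_h[of U V] fin_m by (simp add: m'_def less_top)
      also have "\<dots> = ennreal (enn2real (h U V z) / m')" using m'0 by (intro divide_ennreal) auto
      finally show ?thesis using m'0 by simp
    qed
    have "enn2real (h ?P ?P z) / m' * (enn2real (h ?Q ?Q z) / m') = enn2real (h ?P ?Q z) / m' * (enn2real (h ?Q ?P z) / m')"
      using elim(1-4) unfolding z_def[symmetric] ratio by (simp only: mult_ac)
    then have *: "enn2real (h ?P ?P z) * enn2real (h ?Q ?Q z) = enn2real (h ?P ?Q z) * enn2real (h ?Q ?P z)"
      using m'0 by simp
    have h_real: "h U V z = ennreal (enn2real (h U V z))" for U V
      using fin_h[of U V] by (simp add: less_top)
    have "h ?P ?P z * h ?Q ?Q z = ennreal (enn2real (h ?P ?P z) * enn2real (h ?Q ?Q z))"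
      by (subst (1 2) h_real) (simp add: ennreal_mult)
    also have "\<dots> = h ?P ?Q z * h ?Q ?P z"
      unfolding * by (subst (3 4) h_real) (simp add: ennreal_mult)
    finally have "h ?P ?P z * h ?Q ?Q z = h ?P ?Q z * h ?Q ?P z" .
    then show ?case
      using slice_mass_no_product[OF fin ab c, of A z] fin_m unfolding h_def m_def by blast
  qed
  then show ?thesis by simp
qed

section \<open>Normal tails in a random direction\<close>

interpretation std_normal: real_distribution std_normal_distribution
  by (rule real_dist_normal_dist)

lemma measure_std_normal_singleton: "measure std_normal_distribution {x} = 0"
proof -
  have "emeasure std_normal_distribution {x} = (\<integral>\<^sup>+t. ennreal (std_normal_density t) * indicator {x} t \<partial>lborel)"
    by (rule emeasure_density) auto
  also have "\<dots> = (\<integral>\<^sup>+t. 0 \<partial>(lborel :: real measure))"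
    by (rule nn_integral_cong_AE, rule eventually_mono[OF AE_lborel_singleton[of x]]) simp
  finally have "emeasure std_normal_distribution {x} = 0" by simp
  then show ?thesis by (simp add: measure_def)
qed

lemma normal_tail_eq_measure: "normal_tail z = measure std_normal_distribution {z..}"
proof -
  have "measure std_normal_distribution {z<..} = 1 - measure std_normal_distribution {..z}"
    using std_normal.prob_compl[of "{..z}"] by (simp add: Compl_eq_Diff_UNIV[symmetric])
  moreover have "measure std_normal_distribution {z..} =
      measure std_normal_distribution {z} + measure std_normal_distribution {z<..}"
    using std_normal.finite_measure_Union[of "{z}" "{z<..}"] by (simp only: ivl_disj_un_singleton) simp
  ultimately show ?thesis by (simp add: normal_tail_def cdf_def measure_std_normal_singleton)
qed

lemma normal_tail_strict_antimono:
  assumes "x < y" shows "normal_tail y < normal_tail x"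
proof -
  have "measure std_normal_distribution {x<..y} \<noteq> 0"
  proof
    assume "measure std_normal_distribution {x<..y} = 0"
    then have "emeasure std_normal_distribution {x<..y} = 0"
      by (simp add: std_normal.emeasure_eq_measure)
    then have "AE t in lborel. ennreal (std_normal_density t) * indicator {x<..y} t = 0"
      by (subst (asm) emeasure_density) (auto simp: nn_integral_0_iff_AE)
    then have "AE t in lborel. t \<notin> {x<..y}"
    proof (rule eventually_mono)
      fix t assume "ennreal (std_normal_density t) * indicator {x<..y} t = 0"
      moreover have "0 < std_normal_density t" by (rule normal_density_pos) simp
      ultimately show "t \<notin> {x<..y}" by (auto simp: indicator_def ennreal_eq_0_iff split: if_splits)
    qed
    moreover have "{t \<in> space lborel. \<not> t \<notin> {x<..y}} = {x<..y}" by auto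
    ultimately have "{x<..y} \<in> null_sets lborel"
      using AE_iff_null[of lborel "\<lambda>t. t \<notin> {x<..y}"] by simp
    then show False using assms by (simp add: null_sets_def)
  qed
  then have "0 < measure std_normal_distribution {x<..y}" by (simp add: less_le)
  then show ?thesis using std_normal.cdf_diff_eq[OF assms] by (simp add: normal_tail_def)
qed

text \<open>\<open>the_inv\<close> is meaningful at \<open>y\<close> because the tail is strictly decreasing and, being continuous with limits
1 and 0, attains \<open>y\<close>.\<close>

lemma normal_tail_the_inv:
  assumes "0 < y" "y < 1"
  shows "normal_tail (the_inv normal_tail y) = y"
proof -
  have "inj normal_tail"
    by (rule injI) (metis less_irrefl linorder_neqE_linordered_idom normal_tail_strict_antimono)
  moreover have "y \<in> range normal_tail"
  proof -
    have "\<forall>\<^sub>F x in at_bot. cdf std_normal_distribution x < 1 - y"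
      using std_normal.cdf_lim_at_bot assms by (intro order_tendstoD) auto
    then obtain l where l: "cdf std_normal_distribution l < 1 - y"
      using eventually_happens' trivial_limit_at_bot_linorder by blast
    have "\<forall>\<^sub>F x in at_top. 1 - y < cdf std_normal_distribution x"
      using std_normal.cdf_lim_at_top_prob assms by (intro order_tendstoD) auto
    then obtain u where u: "1 - y < cdf std_normal_distribution u"
      using eventually_happens' trivial_limit_at_top_linorder by blast
    have "l \<le> u" using std_normal.cdf_nondecreasing[of u l] l u by linarith
    then have "\<exists>x. l \<le> x \<and> x \<le> u \<and> cdf std_normal_distribution x = 1 - y"
      using l u by (intro IVT) (auto simp: std_normal.isCont_cdf measure_std_normal_singleton)
    then obtain x where "cdf std_normal_distribution x = 1 - y" by blast
    then have "normal_tail x = y" by (simp add: normal_tail_def)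
    then show ?thesis by auto
  qed
  ultimately show ?thesis by (rule f_the_inv_into_f)
qed

lemma (in prob_space) std_normal_two_sided_tail:
  assumes Y: "distributed M lborel Y (\<lambda>x. ennreal (std_normal_density x))" and z: "0 < z"
  shows "prob {\<omega>\<in>space M. z \<le> \<bar>Y \<omega>\<bar>} = 2 * normal_tail z"
proof -
  have one: "prob {\<omega>\<in>space M. z \<le> X \<omega>} = normal_tail z"
    if "distributed M lborel X (\<lambda>x. ennreal (std_normal_density x))" for X
  proof -
    have "measure (distr M lborel X) {z..} = measure std_normal_distribution {z..}"
      using distributed_distr_eq_density[OF that] by simp
    then show ?thesis using distributed_measurable[OF that]
      by (simp add: measure_distr normal_tail_eq_measure vimage_def Int_def conj_commute)
  qed
  have minus: "distributed M lborel (\<lambda>\<omega>. - Y \<omega>) (\<lambda>x. ennreal (std_normal_density x))"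
    using normal_density_affine[OF Y, of "-1" 0] by simp
  have [measurable]: "Y \<in> borel_measurable M" using distributed_measurable[OF Y] by simp
  have "{\<omega>\<in>space M. z \<le> \<bar>Y \<omega>\<bar>} = {\<omega>\<in>space M. z \<le> Y \<omega>} \<union> {\<omega>\<in>space M. z \<le> - Y \<omega>}"
    by (auto simp: abs_if)
  then have "prob {\<omega>\<in>space M. z \<le> \<bar>Y \<omega>\<bar>} = prob {\<omega>\<in>space M. z \<le> Y \<omega>} + prob {\<omega>\<in>space M. z \<le> - Y \<omega>}"
    using z by (simp only:) (rule finite_measure_Union, auto)
  then show ?thesis using one[OF Y] one[OF minus] by simp
qed

lemma normal_tail_0: "normal_tail 0 = 1 / 2"
proof -
  have d: "distributed std_normal_distribution lborel (\<lambda>x. x) (\<lambda>x. ennreal (std_normal_density x))"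
    by (auto simp: distributed_def distr_id2)
  have minus: "distributed std_normal_distribution lborel (\<lambda>x. - x) (\<lambda>x. ennreal (std_normal_density x))"
    using std_normal.normal_density_affine[OF d, of "-1" 0] by simp
  have "measure std_normal_distribution {0..} = measure (distr std_normal_distribution lborel uminus) {0..}"
    using distributed_distr_eq_density[OF minus] by simp
  also have "\<dots> = measure std_normal_distribution {..0}"
    by (simp add: measure_distr vimage_def atMost_def)
  finally show ?thesis by (simp add: normal_tail_eq_measure[symmetric] normal_tail_def cdf_def)
qed

lemma normal_tail_the_inv_pos:
  assumes "0 < y" "y < 1 / 2"
  shows "0 < the_inv normal_tail y"
proof (rule ccontr)
  assume "\<not> 0 < the_inv normal_tail y"
  then have "normal_tail 0 \<le> normal_tail (the_inv normal_tail y)"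
    using normal_tail_strict_antimono[of "the_inv normal_tail y" 0] by (cases "the_inv normal_tail y = 0") auto
  then show False using normal_tail_the_inv[of y] assms by (simp add: normal_tail_0)
qed

lemma (in prob_space) weighted_sum_two_sided_tail:
  fixes n :: nat
  assumes ind: "indep_vars (\<lambda>_. borel) Y {..<n}"
    and Y: "\<And>i. i < n \<Longrightarrow> distributed M lborel (Y i) (\<lambda>x. ennreal (std_normal_density x))"
    and c: "\<exists>i<n. c i \<noteq> 0" and z: "0 < z"
  shows "prob {\<omega>\<in>space M. z * sqrt (\<Sum>i<n. (c i)\<^sup>2) \<le> \<bar>\<Sum>i<n. c i * Y i \<omega>\<bar>} = 2 * normal_tail z"
proof -
  \<comment> \<open>zero weights are dropped, since a normal density has a positive standard deviation\<close>
  define J where "J = {i\<in>{..<n}. c i \<noteq> 0}"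
  define s where "s = sqrt (\<Sum>i\<in>J. \<bar>c i\<bar>\<^sup>2)"
  have J: "finite J" "J \<noteq> {}" "J \<subseteq> {..<n}" using c by (auto simp: J_def)
  have s: "0 < s" unfolding s_def using J by (intro real_sqrt_gt_zero sum_pos) (auto simp: J_def)
  have "indep_vars (\<lambda>_. borel) (\<lambda>i \<omega>. c i * Y i \<omega>) J"
    using indep_vars_compose2[OF indep_vars_subset[OF ind J(3)], of "\<lambda>i y. c i * y" "\<lambda>_. borel"] by simp
  moreover have "distributed M lborel (\<lambda>\<omega>. c i * Y i \<omega>) (\<lambda>x. ennreal (normal_density 0 \<bar>c i\<bar> x))" if "i \<in> J" for i
    using normal_density_affine[OF Y, of i "c i" 0] that by (simp add: J_def)
  ultimately have "distributed M lborel (\<lambda>\<omega>. \<Sum>i\<in>J. c i * Y i \<omega>) (\<lambda>x. ennreal (normal_density (\<Sum>i\<in>J. 0) s x))"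
    unfolding s_def using J by (intro sum_indep_normal) (auto simp: J_def)
  then have d: "distributed M lborel (\<lambda>\<omega>. \<Sum>i\<in>J. c i * Y i \<omega>) (\<lambda>x. ennreal (normal_density 0 s x))" by simp
  have "distributed M lborel (\<lambda>\<omega>. 0 + (1 / s) * (\<Sum>i\<in>J. c i * Y i \<omega>)) (\<lambda>x. ennreal (normal_density (0 + (1 / s) * 0) (\<bar>1 / s\<bar> * s) x))"
    using s by (intro normal_density_affine[OF d]) auto
  then have d1: "distributed M lborel (\<lambda>\<omega>. (1 / s) * (\<Sum>i\<in>J. c i * Y i \<omega>)) (\<lambda>x. ennreal (std_normal_density x))"
    using s by simp
  have sums: "(\<Sum>i<n. c i * Y i \<omega>) = (\<Sum>i\<in>J. c i * Y i \<omega>)" "(\<Sum>i<n. (c i)\<^sup>2) = (\<Sum>i\<in>J. \<bar>c i\<bar>\<^sup>2)" for \<omega>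
    by (intro sum.mono_neutral_cong_right; auto simp: J_def)+
  have "{\<omega>\<in>space M. z * sqrt (\<Sum>i<n. (c i)\<^sup>2) \<le> \<bar>\<Sum>i<n. c i * Y i \<omega>\<bar>}
      = {\<omega>\<in>space M. z \<le> \<bar>(1 / s) * (\<Sum>i\<in>J. c i * Y i \<omega>)\<bar>}"
    unfolding sums s_def[symmetric] using s by (auto simp: abs_mult field_simps)
  then show ?thesis using std_normal_two_sided_tail[OF d1 z] by simp
qed

text \<open>By independence the joint law of \<open>U\<close> and \<open>W\<close> is a product, so the direction \<open>r (U \<omega>)\<close> may be frozen while
the standard normal variables are integrated out; the bound for a fixed direction does not depend on the
direction. The zero direction is excluded, since it would satisfy the inequality trivially.\<close>

lemma (in prob_space) random_direction_tail:
  fixes n :: nat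
  assumes UW: "indep_var N U N' W"
    and g[measurable]: "\<And>i. i < n \<Longrightarrow> g i \<in> borel_measurable N'"
    and ind: "indep_vars (\<lambda>_. borel) (\<lambda>i \<omega>. g i (W \<omega>)) {..<n}"
    and std: "\<And>i. i < n \<Longrightarrow> distributed M lborel (\<lambda>\<omega>. g i (W \<omega>)) (\<lambda>x. ennreal (std_normal_density x))"
    and r[measurable]: "\<And>i. i < n \<Longrightarrow> (\<lambda>u. r u i) \<in> borel_measurable N" and z: "0 < z"
  defines "B \<equiv> {\<omega>\<in>space M. (\<exists>i<n. r (U \<omega>) i \<noteq> 0) \<and>
      z * sqrt (\<Sum>i<n. (r (U \<omega>) i)\<^sup>2) \<le> \<bar>\<Sum>i<n. r (U \<omega>) i * g i (W \<omega>)\<bar>}"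
  shows "B \<in> events" "emeasure M B \<le> ennreal (2 * normal_tail z)"
proof -
  have U[measurable]: "U \<in> measurable M N" using UW by (rule indep_var_rv1)
  have W[measurable]: "W \<in> measurable M N'" using UW by (rule indep_var_rv2)
  have joint: "distr M N U \<Otimes>\<^sub>M distr M N' W = distr M (N \<Otimes>\<^sub>M N') (\<lambda>\<omega>. (U \<omega>, W \<omega>))"
    using UW by (simp add: indep_var_distribution_eq)
  define A where "A = {w\<in>space (N \<Otimes>\<^sub>M N'). (\<exists>i<n. r (fst w) i \<noteq> 0) \<and>
      z * sqrt (\<Sum>i<n. (r (fst w) i)\<^sup>2) \<le> \<bar>\<Sum>i<n. r (fst w) i * g i (snd w)\<bar>}"
  have rf: "(\<lambda>w. r (fst w) i) \<in> borel_measurable (N \<Otimes>\<^sub>M N')" if "i < n" for i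
    by (rule measurable_compose[OF measurable_fst r[OF that]])
  have ys: "(\<lambda>w. g i (snd w)) \<in> borel_measurable (N \<Otimes>\<^sub>M N')" if "i < n" for i
    by (rule measurable_compose[OF measurable_snd g[OF that]])
  have [measurable]: "(\<lambda>w. \<Sum>i<n. (r (fst w) i)\<^sup>2) \<in> borel_measurable (N \<Otimes>\<^sub>M N')"
    "(\<lambda>w. \<Sum>i<n. r (fst w) i * g i (snd w)) \<in> borel_measurable (N \<Otimes>\<^sub>M N')"
    using rf ys by (auto intro!: borel_measurable_sum borel_measurable_power borel_measurable_times)
  have ex: "(\<exists>i<n. r u i \<noteq> 0) \<longleftrightarrow> (\<Sum>i<n. (r u i)\<^sup>2) \<noteq> 0" for u
    by (subst sum_nonneg_eq_0_iff) auto
  have A[measurable]: "A \<in> sets (N \<Otimes>\<^sub>M N')" unfolding A_def ex by measurable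
  have B: "B = (\<lambda>\<omega>. (U \<omega>, W \<omega>)) -` A \<inter> space M"
    using measurable_space[OF U] measurable_space[OF W] by (auto simp: A_def B_def space_pair_measure)
  show "B \<in> events" unfolding B by measurable
  have slice: "emeasure (distr M N' W) (Pair u -` A) \<le> ennreal (2 * normal_tail z)" if u: "u \<in> space N" for u
  proof (cases "\<exists>i<n. r u i \<noteq> 0")
    case True
    have "Pair u -` A \<in> sets N'" using A by (rule sets_Pair1)
    then have "emeasure (distr M N' W) (Pair u -` A) = emeasure M (W -` (Pair u -` A) \<inter> space M)"
      by (simp add: emeasure_distr)
    also have "W -` (Pair u -` A) \<inter> space M = {\<omega>\<in>space M. z * sqrt (\<Sum>i<n. (r u i)\<^sup>2) \<le> \<bar>\<Sum>i<n. r u i * g i (W \<omega>)\<bar>}"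
      using u True measurable_space[OF W] by (auto simp: A_def space_pair_measure)
    also have "emeasure M \<dots> = ennreal (2 * normal_tail z)"
      using weighted_sum_two_sided_tail[OF ind std True z] by (simp add: emeasure_eq_measure)
    finally show ?thesis by (rule eq_refl)
  next
    case False
    then have "Pair u -` A = {}" by (auto simp: A_def)
    then show ?thesis by simp
  qed
  interpret PU: prob_space "distr M N U" by (rule prob_space_distr) fact
  interpret PY: prob_space "distr M N' W" by (rule prob_space_distr) fact
  have "emeasure M B = emeasure (distr M N U \<Otimes>\<^sub>M distr M N' W) A"
    unfolding joint B by (subst emeasure_distr) auto
  also have "\<dots> = (\<integral>\<^sup>+u. emeasure (distr M N' W) (Pair u -` A) \<partial>distr M N U)"
    by (rule PY.emeasure_pair_measure_alt) (use A in \<open>simp cong: sets_pair_measure_cong\<close>)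
  also have "\<dots> \<le> (\<integral>\<^sup>+u. ennreal (2 * normal_tail z) \<partial>distr M N U)"
    by (intro nn_integral_mono slice) simp
  also have "\<dots> = ennreal (2 * normal_tail z)" using PU.emeasure_space_1 by simp
  finally show "emeasure M B \<le> ennreal (2 * normal_tail z)" .
qed

section \<open>False edges between components\<close>

text \<open>Independence within every row and between the rows makes all \<open>2 * n\<close> parts independent; collecting the
first parts and the second parts gives the claim. The parts are indexed by row and a Boolean.\<close>

lemma (in prob_space) indep_var_of_rowwise:
  fixes f\<^sub>1 f\<^sub>2 :: "'b \<Rightarrow> 'c" and n :: nat
  assumes n: "0 < n" and ind: "indep_vars (\<lambda>_. N) W {..<n}"
    and f[measurable]: "f\<^sub>1 \<in> measurable N N\<^sub>1" "f\<^sub>2 \<in> measurable N N\<^sub>2"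
    and row: "\<And>i S T. i < n \<Longrightarrow> S \<in> sets N\<^sub>1 \<Longrightarrow> T \<in> sets N\<^sub>2 \<Longrightarrow>
      prob {\<omega>\<in>space M. f\<^sub>1 (W i \<omega>) \<in> S \<and> f\<^sub>2 (W i \<omega>) \<in> T} =
      prob {\<omega>\<in>space M. f\<^sub>1 (W i \<omega>) \<in> S} * prob {\<omega>\<in>space M. f\<^sub>2 (W i \<omega>) \<in> T}"
  shows "indep_var (\<Pi>\<^sub>M i\<in>{..<n}. N\<^sub>1) (\<lambda>\<omega>. \<lambda>i\<in>{..<n}. f\<^sub>1 (W i \<omega>))
    (\<Pi>\<^sub>M i\<in>{..<n}. N\<^sub>2) (\<lambda>\<omega>. \<lambda>i\<in>{..<n}. f\<^sub>2 (W i \<omega>))"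
proof -
  define L where "L = (\<lambda>j :: nat \<times> bool. if snd j then N\<^sub>2 else N\<^sub>1)"
  define Z where "Z = (\<lambda>(j :: nat \<times> bool) \<omega>. if snd j then f\<^sub>2 (W (fst j) \<omega>) else f\<^sub>1 (W (fst j) \<omega>))"
  let ?J = "{..<n} \<times> (UNIV :: bool set)"
  have W: "W i \<in> measurable M N" if "i < n" for i using ind that by (auto simp: indep_vars_def2)
  have Zm: "Z j \<in> measurable M (L j)" if "j \<in> ?J" for j
    using measurable_compose[OF W f(1)] measurable_compose[OF W f(2)] that by (auto simp: Z_def L_def)
  have "indep_vars L Z ?J"
  proof (subst indep_vars_finite[where E = "\<lambda>j. sets (L j)"])
    show "\<forall>A\<in>\<Pi> j\<in>?J. sets (L j). prob (\<Inter>j\<in>?J. Z j -` A j \<inter> space M) = (\<Prod>j\<in>?J. prob (Z j -` A j \<inter> space M))"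
    proof
      fix A assume A: "A \<in> (\<Pi> j\<in>?J. sets (L j))"
      have A1: "A (i, False) \<in> sets N\<^sub>1" and A2: "A (i, True) \<in> sets N\<^sub>2" if "i < n" for i
        using Pi_mem[OF A, of "(i, False)"] Pi_mem[OF A, of "(i, True)"] that by (auto simp: L_def)
      define Q where "Q = (\<lambda>i. (f\<^sub>1 -` A (i, False) \<inter> space N) \<inter> (f\<^sub>2 -` A (i, True) \<inter> space N))"
      have Q: "Q i \<in> sets N" if "i < n" for i
        unfolding Q_def using A1[OF that] A2[OF that] by (intro sets.Int measurable_sets[OF f(1)] measurable_sets[OF f(2)])
      have Wsp: "W i \<omega> \<in> space N" if "i < n" "\<omega> \<in> space M" for i \<omega> using measurable_space[OF W] that by auto
      have "(\<Inter>j\<in>?J. Z j -` A j \<inter> space M) = (\<Inter>i\<in>{..<n}. W i -` Q i \<inter> space M)"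
      proof (rule equalityI; rule subsetI)
        fix \<omega> assume \<omega>: "\<omega> \<in> (\<Inter>j\<in>?J. Z j -` A j \<inter> space M)"
        show "\<omega> \<in> (\<Inter>i\<in>{..<n}. W i -` Q i \<inter> space M)"
        proof
          fix i assume "i \<in> {..<n}"
          then have "\<omega> \<in> Z (i, False) -` A (i, False) \<inter> space M" "\<omega> \<in> Z (i, True) -` A (i, True) \<inter> space M"
            using \<omega> by blast+
          then show "\<omega> \<in> W i -` Q i \<inter> space M" using Wsp \<open>i \<in> _\<close> by (auto simp: Z_def Q_def)
        qed
      next
        fix \<omega> assume \<omega>: "\<omega> \<in> (\<Inter>i\<in>{..<n}. W i -` Q i \<inter> space M)"
        show "\<omega> \<in> (\<Inter>j\<in>?J. Z j -` A j \<inter> space M)"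
        proof
          fix j assume "j \<in> ?J"
          then obtain i t where j: "j = (i, t)" "i < n" by (cases j) auto
          then have "\<omega> \<in> W i -` Q i \<inter> space M" using \<omega> by blast
          then show "\<omega> \<in> Z j -` A j \<inter> space M" using j by (cases t) (auto simp: Z_def Q_def)
        qed
      qed
      also have "prob (\<Inter>i\<in>{..<n}. W i -` Q i \<inter> space M) = (\<Prod>i<n. prob (W i -` Q i \<inter> space M))"
        using n Q by (intro indep_varsD_finite[OF ind]) auto
      also have "\<dots> = (\<Prod>i<n. prob (Z (i, False) -` A (i, False) \<inter> space M) * prob (Z (i, True) -` A (i, True) \<inter> space M))"
      proof (rule prod.cong[OF refl])
        fix i assume "i \<in> {..<n}"
        then have i: "i < n" by simp
        have "W i -` Q i \<inter> space M = {\<omega>\<in>space M. f\<^sub>1 (W i \<omega>) \<in> A (i, False) \<and> f\<^sub>2 (W i \<omega>) \<in> A (i, True)}"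
          using Wsp[OF i] by (auto simp: Q_def)
        moreover have "Z (i, False) -` A (i, False) \<inter> space M = {\<omega>\<in>space M. f\<^sub>1 (W i \<omega>) \<in> A (i, False)}"
          "Z (i, True) -` A (i, True) \<inter> space M = {\<omega>\<in>space M. f\<^sub>2 (W i \<omega>) \<in> A (i, True)}"
          by (auto simp: Z_def)
        ultimately show "prob (W i -` Q i \<inter> space M)
            = prob (Z (i, False) -` A (i, False) \<inter> space M) * prob (Z (i, True) -` A (i, True) \<inter> space M)"
          using row[OF i A1[OF i] A2[OF i]] by simp
      qed
      also have "\<dots> = (\<Prod>i<n. \<Prod>t\<in>UNIV. prob (Z (i, t) -` A (i, t) \<inter> space M))"
        by (simp add: UNIV_bool mult.commute)
      also have "\<dots> = (\<Prod>j\<in>?J. prob (Z j -` A j \<inter> space M))"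
        by (simp add: prod.cartesian_product)
      finally show "prob (\<Inter>j\<in>?J. Z j -` A j \<inter> space M) = (\<Prod>j\<in>?J. prob (Z j -` A j \<inter> space M))" .
    qed
  qed (use n Zm in \<open>auto simp: sets.sigma_sets_eq sets.Int_stable dest: sets.sets_into_space[THEN subsetD]\<close>)
  then have 1: "indep_var (PiM ({..<n} \<times> {False}) L) (\<lambda>\<omega>. restrict (\<lambda>j. Z j \<omega>) ({..<n} \<times> {False}))
      (PiM ({..<n} \<times> {True}) L) (\<lambda>\<omega>. restrict (\<lambda>j. Z j \<omega>) ({..<n} \<times> {True}))"
    by (rule indep_var_restrict) auto
  have 2: "(\<lambda>u. \<lambda>i\<in>{..<n}. u (i, t)) \<in> measurable (PiM ({..<n} \<times> {t}) L) (\<Pi>\<^sub>M i\<in>{..<n}. L (i, t))" for t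
  proof (rule measurable_restrict)
    fix i assume "i \<in> {..<n}"
    then show "(\<lambda>u. u (i, t)) \<in> measurable (PiM ({..<n} \<times> {t}) L) (L (i, t))"
      by (intro measurable_component_singleton) simp
  qed
  have "indep_var (\<Pi>\<^sub>M i\<in>{..<n}. L (i, False))
      ((\<lambda>u. \<lambda>i\<in>{..<n}. u (i, False)) \<circ> (\<lambda>\<omega>. restrict (\<lambda>j. Z j \<omega>) ({..<n} \<times> {False})))
      (\<Pi>\<^sub>M i\<in>{..<n}. L (i, True))
      ((\<lambda>u. \<lambda>i\<in>{..<n}. u (i, True)) \<circ> (\<lambda>\<omega>. restrict (\<lambda>j. Z j \<omega>) ({..<n} \<times> {True})))"
    by (rule indep_var_compose[OF 1 2 2])
  moreover have "((\<lambda>u. \<lambda>i\<in>{..<n}. u (i, t)) \<circ> (\<lambda>\<omega>. restrict (\<lambda>j. Z j \<omega>) ({..<n} \<times> {t}))) = (\<lambda>\<omega>. \<lambda>i\<in>{..<n}. Z (i, t) \<omega>)" for t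
    by (auto simp: fun_eq_iff)
  ultimately show ?thesis by (simp add: L_def Z_def)
qed

lemma lasso_residual_cong:
  assumes "\<And>i k. i < n \<Longrightarrow> k \<in> insert a K \<Longrightarrow> D i k = D' i k" and "i < n"
  shows "lasso_residual n K D a l i = lasso_residual n K D' a l i"
proof -
  have "lasso_obj n K D a l = lasso_obj n K D' a l"
    using assms(1) by (auto simp: lasso_obj_def fun_eq_iff intro!: sum.cong)
  then show ?thesis using assms by (simp add: lasso_residual_def lasso_min_def)
qed

text \<open>The normalising constant is positive because otherwise the total mass would be zero, also if the
determinant under the square root were negative or zero.\<close>

lemma centered_normal_imp_gaussian_vector:
  assumes M: "prob_space M" and X: "centered_normal M p S X"
  shows "\<exists>c. gaussian_vector M {..<p} X c (\<lambda>i j. precision S $$ (i, j))"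
proof -
  interpret prob_space M by fact
  let ?A = "\<lambda>i j. precision S $$ (i, j)"
  define c where "c = 1 / sqrt ((2 * pi) ^ p * Determinant.det S)"
  have "mvn_density p S = gauss_kernel {..<p} c ?A"
    by (simp add: fun_eq_iff mvn_density_def gauss_kernel_def quad_form_def pair_form_def c_def)
  then have d: "distributed M (\<Pi>\<^sub>M i\<in>{..<p}. lborel) (random_vector {..<p} X) (\<lambda>x. ennreal (gauss_kernel {..<p} c ?A x))"
    using X by (simp add: centered_normal_def)
  have "0 < c"
  proof (rule ccontr)
    assume "\<not> 0 < c"
    then have "gauss_kernel {..<p} c ?A x \<le> 0" for x by (simp add: gauss_kernel_def mult_nonpos_nonneg)
    then have 0: "(\<lambda>x. ennreal (gauss_kernel {..<p} c ?A x)) = (\<lambda>x. 0)" by (simp add: fun_eq_iff ennreal_neg)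
    have "emeasure M (random_vector {..<p} X -` space (\<Pi>\<^sub>M i\<in>{..<p}. lborel) \<inter> space M) = 0"
      using distributed_emeasure[OF d[unfolded 0] sets.top] by simp
    moreover have "random_vector {..<p} X -` space (\<Pi>\<^sub>M i\<in>{..<p}. lborel) \<inter> space M = space M"
      by (auto simp: random_vector_def space_PiM)
    ultimately show False by (simp add: emeasure_space_1)
  qed
  with d show ?thesis by (auto simp: gaussian_vector_def)
qed

lemma sym_edges: "sym (edges M p X)"
proof (rule symI)
  fix a b assume ab: "(a, b) \<in> edges M p X"
  let ?F = "generated_by M X ({..<p} - {a, b})"
  have "cond_indep M ?F (X a) (X b)" if "cond_indep M ?F (X b) (X a)"
    using that unfolding cond_indep_def by (simp add: conj_commute mult.commute)
  then show "(b, a) \<in> edges M p X" using ab by (auto simp: edges_def insert_commute)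
qed

lemma component_edges_subset:
  assumes "a < p"
  shows "component (edges M p X) a \<subseteq> {..<p}"
proof
  fix x assume "x \<in> component (edges M p X) a"
  then have "(a, x) \<in> (edges M p X)\<^sup>*" by (simp add: component_def)
  then show "x \<in> {..<p}" by (cases rule: rtranclE) (use assms in \<open>auto simp: edges_def\<close>)
qed

text \<open>No edge leaves a component, so \<open>X i\<close> and \<open>X j\<close> are conditionally independent given the rest.\<close>

lemma no_cross_term_outside_component:
  assumes M: "prob_space M" and g: "gaussian_vector M {..<p} X c A"
    and i: "i < p" "i \<in> component (edges M p X) a" and j: "j < p" "j \<notin> component (edges M p X) a"
  shows "A i j + A j i = 0"
proof -
  have "(i, j) \<notin> edges M p X" using i j by (auto simp: component_def dest: rtrancl_into_rtrancl)
  moreover have "i \<noteq> j" using i j by auto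
  ultimately have ci: "cond_indep M (generated_by M X ({..<p} - {i, j})) (X i) (X j)"
    using i j by (auto simp: edges_def)
  have "insert i (insert j ({..<p} - {i, j})) = {..<p}" using i j by auto
  then show ?thesis using cond_indep_imp_no_cross_term[OF M _ \<open>i \<noteq> j\<close> _ _ ci] g by simp
qed

lemma outer_measure_of_le:
  assumes "A \<subseteq> B" "B \<in> sets M" shows "outer_measure_of M A \<le> emeasure M B"
  unfolding outer_measure_of_def using assms by (auto intro: INF_lower)

text \<open>Fix \<open>a\<close> and \<open>b\<close> in different components. The residual of the lasso restricted to the component \<open>C\<close> of
\<open>a\<close>, and the penalty, are functions of the observations in \<open>C\<close>, and these are independent of the
observations of \<open>b\<close>. Since the residual is no longer than the response, the inner product with the
observations of \<open>b\<close> reaches the penalty only if a standard normal variable reaches the quantile \<open>z\<close> in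
absolute value, and \<open>z\<close> is chosen such that this has probability \<open>\<alpha> / p\<^sup>2\<close>. The exceptional set also
contains the null event that the first observation of \<open>a\<close> is zero; outside it the penalty is positive.\<close>

lemma false_edge_event:
  fixes M :: "'a measure" and n p :: nat and \<alpha> :: real
  assumes M: "prob_space M" and X: "centered_normal M p S X"
    and ind: "prob_space.indep_vars M (\<lambda>i. \<Pi>\<^sub>M k\<in>{..<p}. borel) (\<lambda>i. random_vector {..<p} (obs i)) {..<n}"
    and law: "\<And>i. i < n \<Longrightarrow> distr M (\<Pi>\<^sub>M k\<in>{..<p}. borel) (random_vector {..<p} (obs i)) =
       distr M (\<Pi>\<^sub>M k\<in>{..<p}. borel) (random_vector {..<p} X)"
    and var: "\<And>a. a < p \<Longrightarrow> prob_space.variance M (X a) = 1"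
    and n: "0 < n" and \<alpha>: "0 < \<alpha>" "\<alpha> < 1" and a: "a < p" and b: "b < p"
  defines "C \<equiv> component (edges M p X) a"
  assumes bC: "b \<notin> C"
  obtains Bad where "Bad \<in> sets M" "emeasure M Bad \<le> ennreal (\<alpha> / (real p)\<^sup>2)"
    "\<And>\<omega>. \<omega> \<in> space M - Bad \<Longrightarrow> 0 < penalty n p (\<lambda>i k. obs i k \<omega>) \<alpha> a \<and>
      \<bar>2 * (\<Sum>i<n. lasso_residual n (C - {a}) (\<lambda>i k. obs i k \<omega>) a (penalty n p (\<lambda>i k. obs i k \<omega>) \<alpha> a) i
          * obs i b \<omega>) / real n\<bar> < penalty n p (\<lambda>i k. obs i k \<omega>) \<alpha> a"
proof -
  interpret prob_space M by fact
  let ?N = "\<Pi>\<^sub>M k\<in>{..<p}. borel :: real measure"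
  obtain c where g: "gaussian_vector M {..<p} X c (\<lambda>i j. precision S $$ (i, j))"
    using centered_normal_imp_gaussian_vector[OF M X] by blast
  have Xrv: "random_vector {..<p} X \<in> measurable M ?N"
    using g by (auto simp: gaussian_vector_def dest!: distributed_measurable cong: measurable_cong_sets)
      (simp add: measurable_cong_sets[OF refl sets_PiM_lborel])
  have Orv: "random_vector {..<p} (obs i) \<in> measurable M ?N" if "i < n" for i
    using ind that by (auto simp: indep_vars_def2)
  have transfer: "prob {\<omega>\<in>space M. random_vector {..<p} (obs i) \<omega> \<in> Q} = prob {\<omega>\<in>space M. random_vector {..<p} X \<omega> \<in> Q}"
    if i: "i < n" and Q: "Q \<in> sets ?N" for i Q
  proof -
    have "measure (distr M ?N (random_vector {..<p} (obs i))) Q = measure (distr M ?N (random_vector {..<p} X)) Q"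
      using law[OF i] by simp
    then show ?thesis using Q by (simp add: measure_distr Orv[OF i] Xrv vimage_def Int_def conj_commute)
  qed

  define B where "B = {..<p} - C"
  have aC: "a \<in> C" by (simp add: C_def component_def)
  have Cp: "C \<subseteq> {..<p}" unfolding C_def using a by (rule component_edges_subset)
  have finC: "finite C" using Cp by (rule finite_subset) simp
  have CB: "C \<union> B = {..<p}" "C \<inter> B = {}" "B \<subseteq> {..<p}" "b \<in> B" using Cp b bC by (auto simp: B_def)
  have cross: "precision S $$ (i, j) + precision S $$ (j, i) = 0" if "i \<in> C" "j \<in> B" for i j
    using no_cross_term_outside_component[OF M g, of i a j] that Cp by (auto simp: B_def C_def)

  let ?NC = "\<Pi>\<^sub>M k\<in>C. borel :: real measure" and ?NB = "\<Pi>\<^sub>M k\<in>B. borel :: real measure"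
  have rC: "(\<lambda>x. restrict x C) \<in> measurable ?N ?NC" and rB: "(\<lambda>x. restrict x B) \<in> measurable ?N ?NB"
    using Cp CB(3) by (auto intro: measurable_restrict_subset)
  have rowC: "restrict (random_vector {..<p} Y \<omega>) C = random_vector C Y \<omega>"
    and rowB: "restrict (random_vector {..<p} Y \<omega>) B = random_vector B Y \<omega>" for Y \<omega>
    using Cp CB(3) by (simp_all add: restrict_random_vector)
  have blocks: "prob {\<omega>\<in>space M. restrict (random_vector {..<p} (obs i) \<omega>) C \<in> U \<and> restrict (random_vector {..<p} (obs i) \<omega>) B \<in> V}
      = prob {\<omega>\<in>space M. restrict (random_vector {..<p} (obs i) \<omega>) C \<in> U} * prob {\<omega>\<in>space M. restrict (random_vector {..<p} (obs i) \<omega>) B \<in> V}"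
    if i: "i < n" and U: "U \<in> sets ?NC" and V: "V \<in> sets ?NB" for i U V
  proof -
    let ?U = "(\<lambda>x. restrict x C) -` U \<inter> space ?N" and ?V = "(\<lambda>x. restrict x B) -` V \<inter> space ?N"
    have UV: "?U \<in> sets ?N" "?V \<in> sets ?N" using measurable_sets[OF rC U] measurable_sets[OF rB V] by auto
    have sp: "random_vector {..<p} Y \<omega> \<in> space ?N" for Y \<omega> by (auto simp: random_vector_def space_PiM)
    have "prob {\<omega>\<in>space M. random_vector C X \<omega> \<in> U \<and> random_vector B X \<omega> \<in> V}
        = prob {\<omega>\<in>space M. random_vector C X \<omega> \<in> U} * prob {\<omega>\<in>space M. random_vector B X \<omega> \<in> V}"
      using gaussian_blocks_prob[OF M _ CB(2) cross U V] g CB(1) by simp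
    then show ?thesis
      using transfer[OF i sets.Int[OF UV]] transfer[OF i UV(1)] transfer[OF i UV(2)]
      by (simp add: sp rowC rowB)
  qed
  define U where "U = (\<lambda>\<omega>. \<lambda>i\<in>{..<n}. restrict (random_vector {..<p} (obs i) \<omega>) C)"
  have indUB: "indep_var (\<Pi>\<^sub>M i\<in>{..<n}. ?NC) U (\<Pi>\<^sub>M i\<in>{..<n}. ?NB) (\<lambda>\<omega>. \<lambda>i\<in>{..<n}. restrict (random_vector {..<p} (obs i) \<omega>) B)"
    unfolding U_def
    by (rule indep_var_of_rowwise[where N = ?N and W = "\<lambda>i. random_vector {..<p} (obs i)"
        and f\<^sub>1 = "\<lambda>x. restrict x C" and f\<^sub>2 = "\<lambda>x. restrict x B"])
      (fact n, fact ind, fact rC, fact rB, rule blocks)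
  have comp: "(\<lambda>x. x k) \<in> measurable ?N borel" if "k < p" for k
    by (rule measurable_component_singleton) (use that in simp)
  have obs_meas: "obs i k \<in> borel_measurable M" if "i < n" "k < p" for i k
    using measurable_compose[OF Orv[OF that(1)] comp[OF that(2)]] that by (simp add: random_vector_def)
  have std: "distributed M lborel (obs i k) (\<lambda>x. ennreal (std_normal_density x))" if i: "i < n" and k: "k < p" for i k
  proof -
    have X_std: "distributed M lborel (X k) (\<lambda>x. ennreal (std_normal_density x))"
      using gaussian_vector_component_std_normal[OF M g _ var[OF k]] k by simp
    have "distr M borel (obs i k) = distr (distr M ?N (random_vector {..<p} (obs i))) borel (\<lambda>x. x k)"
      using k by (subst distr_distr[OF comp[OF k] Orv[OF i]]) (simp add: comp_def random_vector_def)
    also have "\<dots> = distr M borel (X k)"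
      unfolding law[OF i] using k by (subst distr_distr[OF comp[OF k] Xrv]) (simp add: comp_def random_vector_def)
    finally have "distr M borel (obs i k) = distr M borel (X k)" .
    moreover have "distr M lborel Y = distr M borel Y" for Y :: "'a \<Rightarrow> real" by (rule distr_cong) auto
    ultimately have "distr M lborel (obs i k) = distr M lborel (X k)" by simp
    then show ?thesis using X_std obs_meas[OF i k] by (simp add: distributed_def)
  qed
  have Yind: "indep_vars (\<lambda>_. borel) (\<lambda>i. obs i b) {..<n}"
    using indep_vars_compose2[OF ind, of "\<lambda>_ x. x b" "\<lambda>_. borel"] comp[OF b] b by (simp add: random_vector_def)
  define W where "W = (\<lambda>\<omega>. \<lambda>i\<in>{..<n}. restrict (random_vector {..<p} (obs i) \<omega>) B)"
  have W: "W \<omega> i b = obs i b \<omega>" if "i < n" for i \<omega>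
    using that CB(4) b by (simp add: W_def random_vector_def)
  have Wm: "(\<lambda>w. w i b) \<in> borel_measurable (\<Pi>\<^sub>M i\<in>{..<n}. ?NB)" if "i < n" for i
  proof -
    have 1: "(\<lambda>w. w i) \<in> measurable (\<Pi>\<^sub>M i\<in>{..<n}. ?NB) ?NB"
      by (rule measurable_component_singleton) (use that in simp)
    have 2: "(\<lambda>x. x b) \<in> measurable ?NB borel" by (rule measurable_component_singleton) (rule CB(4))
    show ?thesis by (rule measurable_compose[OF 1 2])
  qed

  define z where "z = the_inv normal_tail (\<alpha> / (2 * (real p)\<^sup>2))"
  have p1: "1 \<le> (real p)\<^sup>2" using a by simp
  have lvl: "0 < \<alpha> / (2 * (real p)\<^sup>2)" "\<alpha> / (2 * (real p)\<^sup>2) < 1 / 2"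
  proof -
    have p0: "0 < (real p)\<^sup>2" using p1 by linarith
    show "0 < \<alpha> / (2 * (real p)\<^sup>2)" using \<alpha> p0 by (intro divide_pos_pos) auto
    have "\<alpha> < (real p)\<^sup>2" using \<alpha> p1 by linarith
    then show "\<alpha> / (2 * (real p)\<^sup>2) < 1 / 2" using p0 by (simp add: divide_less_eq)
  qed
  have z: "0 < z" unfolding z_def by (rule normal_tail_the_inv_pos[OF lvl])
  have tail: "2 * normal_tail z = \<alpha> / (real p)\<^sup>2"
    using normal_tail_the_inv[of "\<alpha> / (2 * (real p)\<^sup>2)"] lvl by (simp add: z_def)

  \<comment> \<open>\<open>u i k\<close> stands for the \<open>i\<close>-th observation of node \<open>k \<in> C\<close>; \<open>l u\<close> is the penalty of node \<open>a\<close>\<close>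
  define l where "l = (\<lambda>u :: nat \<Rightarrow> nat \<Rightarrow> real. 2 * sqrt ((\<Sum>i<n. (u i a)\<^sup>2) / real n) / sqrt (real n) * z)"
  define r where "r = (\<lambda>u. lasso_residual n (C - {a}) u a (l u))"
  have data: "(\<lambda>u. u i k) \<in> borel_measurable (\<Pi>\<^sub>M i\<in>{..<n}. ?NC)" if "i < n" "k \<in> C" for i k
  proof -
    have 1: "(\<lambda>u. u i) \<in> measurable (\<Pi>\<^sub>M i\<in>{..<n}. ?NC) ?NC"
      by (rule measurable_component_singleton) (use that in simp)
    have 2: "(\<lambda>x. x k) \<in> measurable ?NC borel" by (rule measurable_component_singleton) (rule that(2))
    show ?thesis by (rule measurable_compose[OF 1 2])
  qed
  have lm: "l \<in> borel_measurable (\<Pi>\<^sub>M i\<in>{..<n}. ?NC)"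
  proof -
    have [measurable]: "(\<lambda>u. \<Sum>i<n. (u i a)\<^sup>2) \<in> borel_measurable (\<Pi>\<^sub>M i\<in>{..<n}. ?NC)"
      by (intro borel_measurable_sum borel_measurable_power data aC) simp
    show ?thesis unfolding l_def by measurable
  qed
  have l_nonneg: "0 \<le> l u" for u using z by (simp add: l_def sum_nonneg)
  have l_pos: "0 < l u \<or> (\<forall>i<n. u i a = 0)" for u
  proof (cases "(\<Sum>i<n. (u i a)\<^sup>2) = 0")
    case True then show ?thesis by (subst (asm) sum_nonneg_eq_0_iff) auto
  next
    case False
    then have "0 < (\<Sum>i<n. (u i a)\<^sup>2)" by (simp add: less_le sum_nonneg)
    then show ?thesis using z n by (simp add: l_def)
  qed
  have ex: "\<exists>\<phi>. lasso_min n (C - {a}) u a (l u) \<phi>" for u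
    using finC l_pos[of u] l_nonneg[of u] by (intro lasso_min_exists) auto
  have rm: "(\<lambda>u. r u i) \<in> borel_measurable (\<Pi>\<^sub>M i\<in>{..<n}. ?NC)" if "i < n" for i
    unfolding r_def
  proof (rule measurable_lasso_residual[OF _ n that])
    show "(\<lambda>u. u j k) \<in> borel_measurable (\<Pi>\<^sub>M i\<in>{..<n}. ?NC)" if "j < n" "k \<in> insert a (C - {a})" for j k
      using data[OF that(1)] that(2) aC by blast
  qed (use finC lm l_nonneg ex in auto)

  define B1 where "B1 = {\<omega>\<in>space M. (\<exists>i<n. r (U \<omega>) i \<noteq> 0) \<and>
      z * sqrt (\<Sum>i<n. (r (U \<omega>) i)\<^sup>2) \<le> \<bar>\<Sum>i<n. r (U \<omega>) i * obs i b \<omega>\<bar>}"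
  have B1: "B1 \<in> sets M" "emeasure M B1 \<le> ennreal (\<alpha> / (real p)\<^sup>2)"
  proof -
    have ind': "indep_vars (\<lambda>_. borel) (\<lambda>i \<omega>. W \<omega> i b) {..<n}"
      using Yind by (subst indep_vars_cong[OF refl]) (auto simp: W)
    have std': "distributed M lborel (\<lambda>\<omega>. W \<omega> i b) (\<lambda>x. ennreal (std_normal_density x))" if "i < n" for i
      using std[OF that b] by (simp add: W that)
    have eq: "{\<omega>\<in>space M. (\<exists>i<n. r (U \<omega>) i \<noteq> 0) \<and>
        z * sqrt (\<Sum>i<n. (r (U \<omega>) i)\<^sup>2) \<le> \<bar>\<Sum>i<n. r (U \<omega>) i * W \<omega> i b\<bar>} = B1"
    proof -
      have "(\<Sum>i<n. r (U \<omega>) i * W \<omega> i b) = (\<Sum>i<n. r (U \<omega>) i * obs i b \<omega>)" for \<omega>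
        by (rule sum.cong) (simp_all add: W)
      then show ?thesis unfolding B1_def by (simp only:)
    qed
    note tail_bound = random_direction_tail[where U = U and W = W and g = "\<lambda>i w. w i b" and r = r and z = z and n = n
        and N = "\<Pi>\<^sub>M i\<in>{..<n}. ?NC" and N' = "\<Pi>\<^sub>M i\<in>{..<n}. ?NB", unfolded eq tail]
    show "B1 \<in> sets M"
      by (rule tail_bound(1)) (fact indUB[folded W_def], erule Wm, fact ind', erule std', erule rm, fact z)
    show "emeasure M B1 \<le> ennreal (\<alpha> / (real p)\<^sup>2)"
      by (rule tail_bound(2)) (fact indUB[folded W_def], erule Wm, fact ind', erule std', erule rm, fact z)
  qed
  define B0 where "B0 = {\<omega>\<in>space M. obs 0 a \<omega> = 0}"
  have B0: "B0 \<in> sets M" "emeasure M B0 = 0"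
  proof -
    note [measurable] = obs_meas[OF n a]
    show "B0 \<in> sets M" unfolding B0_def by measurable
    have "emeasure M (obs 0 a -` {0} \<inter> space M) = emeasure (distr M lborel (obs 0 a)) {0}"
      by (subst emeasure_distr) auto
    also have "\<dots> = emeasure std_normal_distribution {0}"
      using distributed_distr_eq_density[OF std[OF n a]] by simp
    also have "\<dots> = 0" using measure_std_normal_singleton[of 0] by (simp add: std_normal.emeasure_eq_measure)
    finally show "emeasure M B0 = 0" by (simp add: B0_def vimage_def Int_def conj_commute)
  qed
  show thesis
  proof (rule that[of "B1 \<union> B0"])
    show "B1 \<union> B0 \<in> sets M" using B1 B0 by auto
    have "emeasure M (B1 \<union> B0) \<le> emeasure M B1 + emeasure M B0" using B1 B0 by (intro emeasure_subadditive) auto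
    then show "emeasure M (B1 \<union> B0) \<le> ennreal (\<alpha> / (real p)\<^sup>2)" using B1 B0 by (simp add: order.trans)
    fix \<omega> assume \<omega>: "\<omega> \<in> space M - (B1 \<union> B0)"
    let ?D = "\<lambda>i k. obs i k \<omega>"
    define s where "s = (\<Sum>i<n. (obs i a \<omega>)\<^sup>2)"
    have UD: "U \<omega> i k = obs i k \<omega>" if "i < n" "k \<in> C" for i k
      using that Cp by (auto simp: U_def random_vector_def)
    have pen: "penalty n p ?D \<alpha> a = l (U \<omega>)"
      using aC by (simp add: penalty_def sigma_hat_def l_def z_def UD)
    have res: "lasso_residual n (C - {a}) ?D a (l (U \<omega>)) i = r (U \<omega>) i" if "i < n" for i
      unfolding r_def by (rule lasso_residual_cong) (use that UD aC in auto)
    have "l (U \<omega>) = 2 * sqrt (s / real n) / sqrt (real n) * z" using aC by (simp add: l_def s_def UD)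
    also have "\<dots> = 2 * (z * sqrt s) / real n" using n by (simp add: real_sqrt_divide field_simps)
    finally have l_eq: "l (U \<omega>) = 2 * (z * sqrt s) / real n" .
    have "obs 0 a \<omega> \<noteq> 0" using \<omega> by (auto simp: B0_def)
    then have lpos: "0 < l (U \<omega>)" using l_pos[of "U \<omega>"] UD[OF n aC] n by auto
    have "\<bar>\<Sum>i<n. r (U \<omega>) i * obs i b \<omega>\<bar> < z * sqrt s"
    proof (cases "\<exists>i<n. r (U \<omega>) i \<noteq> 0")
      case True
      then have "\<bar>\<Sum>i<n. r (U \<omega>) i * obs i b \<omega>\<bar> < z * sqrt (\<Sum>i<n. (r (U \<omega>) i)\<^sup>2)"
        using \<omega> by (auto simp: B1_def)
      also have "(\<Sum>i<n. (r (U \<omega>) i)\<^sup>2) \<le> (\<Sum>i<n. (U \<omega> i a)\<^sup>2)"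
        unfolding r_def lasso_residual_def
        by (rule lasso_residual_le[OF someI_ex[OF ex] l_nonneg n])
      also have "(\<Sum>i<n. (U \<omega> i a)\<^sup>2) = s" using aC by (simp add: s_def UD)
      finally show ?thesis using z by simp
    next
      case False
      then show ?thesis using lpos n by (simp add: l_eq zero_less_mult_iff zero_less_divide_iff)
    qed
    then have "2 * \<bar>\<Sum>i<n. r (U \<omega>) i * obs i b \<omega>\<bar> / real n < l (U \<omega>)"
      unfolding l_eq using n by (intro divide_strict_right_mono) auto
    then show "0 < penalty n p ?D \<alpha> a \<and>
      \<bar>2 * (\<Sum>i<n. lasso_residual n (C - {a}) ?D a (penalty n p ?D \<alpha> a) i * obs i b \<omega>) / real n\<bar> < penalty n p ?D \<alpha> a"
      unfolding pen using lpos by (simp add: res abs_mult)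
  qed
qed

text \<open>Outside the union of the exceptional sets no node selects a node of another component, by
\<open>lasso_no_spurious_coefficients\<close>. Every estimated edge, under either combination rule, then joins two
nodes of one component, and so does every chain of estimated edges. There are at most \<open>p\<^sup>2\<close> exceptional
sets, and being measurable they bound the outer measure.\<close>

lemma component_error_bound:
  fixes M :: "'a measure" and n p :: nat and \<alpha> :: real
  assumes M: "prob_space M" and X: "centered_normal M p S X"
    and ind: "prob_space.indep_vars M (\<lambda>i. \<Pi>\<^sub>M k\<in>{..<p}. borel) (\<lambda>i. random_vector {..<p} (obs i)) {..<n}"
    and law: "\<And>i. i < n \<Longrightarrow> distr M (\<Pi>\<^sub>M k\<in>{..<p}. borel) (random_vector {..<p} (obs i)) =
       distr M (\<Pi>\<^sub>M k\<in>{..<p}. borel) (random_vector {..<p} X)"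
    and var: "\<And>a. a < p \<Longrightarrow> prob_space.variance M (X a) = 1"
    and n: "0 < n" and \<alpha>: "0 < \<alpha>" "\<alpha> < 1"
    and lasso: "\<And>a \<omega>. a < p \<Longrightarrow> \<omega> \<in> space M \<Longrightarrow>
      is_lasso n p (\<lambda>i k. obs i k \<omega>) a (penalty n p (\<lambda>i k. obs i k \<omega>) \<alpha> a) (T a \<omega>)"
    and R: "\<And>x y. R x y \<Longrightarrow> x \<or> y"
  shows "outer_measure_of M {\<omega>\<in>space M. \<exists>a<p. \<not> component (est_edges R p (\<lambda>a. T a \<omega>)) a \<subseteq> component (edges M p X) a}
    \<le> ennreal \<alpha>"
proof -
  let ?C = "component (edges M p X)"
  define P where "P = {(a, b). a < p \<and> b < p \<and> b \<notin> ?C a}"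
  have P: "P \<subseteq> {..<p} \<times> {..<p}" by (auto simp: P_def)
  then have finP: "finite P" by (rule finite_subset) simp
  define controls where "controls = (\<lambda>a b Bad. Bad \<in> sets M \<and> emeasure M Bad \<le> ennreal (\<alpha> / (real p)\<^sup>2) \<and>
    (\<forall>\<omega>\<in>space M - Bad. 0 < penalty n p (\<lambda>i k. obs i k \<omega>) \<alpha> a \<and>
      \<bar>2 * (\<Sum>i<n. lasso_residual n (?C a - {a}) (\<lambda>i k. obs i k \<omega>) a (penalty n p (\<lambda>i k. obs i k \<omega>) \<alpha> a) i
          * obs i b \<omega>) / real n\<bar> < penalty n p (\<lambda>i k. obs i k \<omega>) \<alpha> a))"
  have "\<exists>Bad. controls a b Bad" if "(a, b) \<in> P" for a b
  proof -
    have ab: "a < p" "b < p" "b \<notin> ?C a" using that by (auto simp: P_def)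
    obtain Bad where "Bad \<in> sets M" "emeasure M Bad \<le> ennreal (\<alpha> / (real p)\<^sup>2)"
      "\<And>\<omega>. \<omega> \<in> space M - Bad \<Longrightarrow> 0 < penalty n p (\<lambda>i k. obs i k \<omega>) \<alpha> a \<and>
        \<bar>2 * (\<Sum>i<n. lasso_residual n (?C a - {a}) (\<lambda>i k. obs i k \<omega>) a (penalty n p (\<lambda>i k. obs i k \<omega>) \<alpha> a) i
          * obs i b \<omega>) / real n\<bar> < penalty n p (\<lambda>i k. obs i k \<omega>) \<alpha> a"
      by (rule false_edge_event[OF M X ind law var n \<alpha> ab]) blast+
    then show ?thesis unfolding controls_def by blast
  qed
  then obtain Bad where controls: "\<And>a b. (a, b) \<in> P \<Longrightarrow> controls a b (Bad (a, b))"
    by (metis (no_types, lifting) case_prod_conv)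
  have Bad: "Bad ab \<in> sets M" "emeasure M (Bad ab) \<le> ennreal (\<alpha> / (real p)\<^sup>2)" if "ab \<in> P" for ab
    using controls[of "fst ab" "snd ab"] that by (auto simp: controls_def)
  have good: "0 < penalty n p (\<lambda>i k. obs i k \<omega>) \<alpha> a \<and>
      \<bar>2 * (\<Sum>i<n. lasso_residual n (?C a - {a}) (\<lambda>i k. obs i k \<omega>) a (penalty n p (\<lambda>i k. obs i k \<omega>) \<alpha> a) i
          * obs i b \<omega>) / real n\<bar> < penalty n p (\<lambda>i k. obs i k \<omega>) \<alpha> a"
    if "(a, b) \<in> P" "\<omega> \<in> space M - Bad (a, b)" for a b \<omega>
    using controls[OF that(1)] that(2) unfolding controls_def by blast
  let ?B = "\<Union>ab\<in>P. Bad ab"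
  have no_false_edge: "T a \<omega> b = 0" if \<omega>: "\<omega> \<in> space M - ?B" and ab: "(a, b) \<in> P" for a b \<omega>
  proof -
    let ?D = "\<lambda>i k. obs i k \<omega>" and ?K = "?C a - {a}" and ?G = "{..<p} - {a}"
    let ?l = "penalty n p ?D \<alpha> a"
    have a: "a < p" and aC: "a \<in> ?C a" using ab by (auto simp: P_def component_def)
    have Cp: "?C a \<subseteq> {..<p}" using a by (rule component_edges_subset)
    have l: "0 < ?l" using good[OF ab] \<omega> ab by blast
    have ex: "\<exists>\<phi>. lasso_min n ?K ?D a ?l \<phi>"
      using l Cp by (intro lasso_min_exists) (auto intro: finite_subset)
    have GK: "(a, c) \<in> P" if "c \<in> ?G - ?K" for c using that a by (auto simp: P_def)
    show ?thesis
    proof (rule lasso_no_spurious_coefficients[OF _ _ someI_ex[OF ex] _ is_lasso_imp_lasso_min[OF lasso[OF a]]])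
      show "b \<in> ?G - ?K" using ab aC by (auto simp: P_def)
      fix c assume "c \<in> ?G - ?K"
      from good[OF GK[OF this], of \<omega>] \<omega> GK[OF this]
      show "\<bar>2 * (\<Sum>i<n. (obs i a \<omega> - (\<Sum>k\<in>?K. obs i k \<omega> * (SOME \<phi>. lasso_min n ?K ?D a ?l \<phi>) k)) * obs i c \<omega>) / real n\<bar> < ?l"
        unfolding lasso_residual_def by blast
    qed (use l Cp \<omega> in auto)
  qed
  have "{\<omega>\<in>space M. \<exists>a<p. \<not> component (est_edges R p (\<lambda>a. T a \<omega>)) a \<subseteq> ?C a} \<subseteq> ?B"
  proof (rule subsetI, rule ccontr)
    fix \<omega> assume bad: "\<omega> \<in> {\<omega>\<in>space M. \<exists>a<p. \<not> component (est_edges R p (\<lambda>a. T a \<omega>)) a \<subseteq> ?C a}" and "\<omega> \<notin> ?B"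
    then have \<omega>: "\<omega> \<in> space M - ?B" by auto
    have supp: "(a, b) \<in> (edges M p X)\<^sup>*" if "a < p" "b < p" "T a \<omega> b \<noteq> 0" for a b
      using no_false_edge[OF \<omega>, of a b] that by (auto simp: P_def component_def)
    have "est_edges R p (\<lambda>a. T a \<omega>) \<subseteq> (edges M p X)\<^sup>*"
    proof (rule subrelI)
      fix x y assume xy: "(x, y) \<in> est_edges R p (\<lambda>a. T a \<omega>)"
      then have "T y \<omega> x \<noteq> 0 \<or> T x \<omega> y \<noteq> 0" by (auto simp: est_edges_def dest: R)
      moreover have "x < p" "y < p" using xy by (auto simp: est_edges_def)
      ultimately show "(x, y) \<in> (edges M p X)\<^sup>*"
        using supp[of x y] supp[of y x] sym_rtrancl[OF sym_edges] by (metis symE)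
    qed
    then have "(est_edges R p (\<lambda>a. T a \<omega>))\<^sup>* \<subseteq> (edges M p X)\<^sup>*" by (rule rtrancl_subset_rtrancl)
    then show False using bad by (auto simp: component_def)
  qed
  then have "outer_measure_of M {\<omega>\<in>space M. \<exists>a<p. \<not> component (est_edges R p (\<lambda>a. T a \<omega>)) a \<subseteq> ?C a} \<le> emeasure M ?B"
    using finP Bad(1) by (intro outer_measure_of_le) auto
  also have "\<dots> \<le> (\<Sum>ab\<in>P. emeasure M (Bad ab))" using finP Bad(1) by (intro emeasure_subadditive_finite) auto
  also have "\<dots> \<le> (\<Sum>ab\<in>P. ennreal (\<alpha> / (real p)\<^sup>2))" by (intro sum_mono Bad(2))
  also have "\<dots> = ennreal (real (card P) * (\<alpha> / (real p)\<^sup>2))"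
    using \<alpha> by (subst ennreal_mult) (auto simp: ennreal_of_nat_eq_real_of_nat)
  also have "\<dots> \<le> ennreal \<alpha>"
  proof (rule ennreal_leI, cases "p = 0")
    case False
    have "card P \<le> card ({..<p} \<times> {..<p})" using P by (intro card_mono) auto
    then have "real (card P) \<le> (real p)\<^sup>2" by (simp add: power2_eq_square flip: of_nat_mult)
    then have "real (card P) * \<alpha> \<le> (real p)\<^sup>2 * \<alpha>" using \<alpha> by (intro mult_right_mono) auto
    then show "real (card P) * (\<alpha> / (real p)\<^sup>2) \<le> \<alpha>" using False by (simp add: field_simps)
  qed (use \<alpha> in simp)
  finally show ?thesis .
qed

theorem theorem3:
  fixes M :: "nat \<Rightarrow> 'a measure"
    and p :: "nat \<Rightarrow> nat"
    and S :: "nat \<Rightarrow> real mat"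
    and X :: "nat \<Rightarrow> nat \<Rightarrow> 'a \<Rightarrow> real"
    and obs :: "nat \<Rightarrow> nat \<Rightarrow> nat \<Rightarrow> 'a \<Rightarrow> real"
    and \<theta>hat :: "nat \<Rightarrow> nat \<Rightarrow> 'a \<Rightarrow> nat \<Rightarrow> real"
    and R :: "bool \<Rightarrow> bool \<Rightarrow> bool"
    and \<gamma> v \<kappa> \<tau> \<delta> \<xi> \<delta>' \<alpha> :: real
  assumes "\<And>n. n \<ge> 1 \<Longrightarrow> prob_space (M n)"
    and "\<And>n. n \<ge> 1 \<Longrightarrow> centered_normal (M n) (p n) (S n) (X n)"
    and "\<And>n. n \<ge> 1 \<Longrightarrow> prob_space.indep_vars (M n) (\<lambda>i. \<Pi>\<^sub>M k\<in>{..<p n}. borel)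
           (\<lambda>i. random_vector {..<p n} (obs n i)) {..<n}"
    and "\<And>n i. n \<ge> 1 \<Longrightarrow> i < n \<Longrightarrow>
           distr (M n) (\<Pi>\<^sub>M k\<in>{..<p n}. borel) (random_vector {..<p n} (obs n i)) =
           distr (M n) (\<Pi>\<^sub>M k\<in>{..<p n}. borel) (random_vector {..<p n} (X n))"
    and "\<gamma> > 0" and "(\<lambda>n. real (p n)) \<in> O(\<lambda>n. real n powr \<gamma>)"
    and "\<And>n a. n \<ge> 1 \<Longrightarrow> a < p n \<Longrightarrow> prob_space.variance (M n) (X n a) = 1"
    and "v\<^sup>2 > 0"
    and "\<And>n a. n \<ge> 1 \<Longrightarrow> a < p n \<Longrightarrow>
           AE \<omega> in M n. cond_variance (M n) (generated_by (M n) (X n) ({..<p n} - {a})) (X n a) \<omega> \<ge> v\<^sup>2"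
    and "0 \<le> \<kappa>" and "\<kappa> < 1"
    and "(\<lambda>n. real (MAX a\<in>{..<p n}. card (neighborhood (M n) (p n) (X n) a)))
           \<in> O(\<lambda>n. real n powr \<kappa>)"
    and "\<And>n a b. n \<ge> 1 \<Longrightarrow> a < p n \<Longrightarrow> b < p n \<Longrightarrow> b \<in> neighborhood (M n) (p n) (X n) a \<Longrightarrow>
           l1_norm (p n)
             (opt_coeff (M n) (p n) (X n) a (neighborhood (M n) (p n) (X n) b - {a})) \<le> \<tau>"
    and "\<delta> > 0" and "\<xi> > \<kappa>"
    and "\<And>n a b. n \<ge> 1 \<Longrightarrow> (a, b) \<in> edges (M n) (p n) (X n) \<Longrightarrow>
           \<bar>partial_corr (S n) a b\<bar> \<ge> \<delta> * real n powr (- (1 - \<xi>) / 2)"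
    and "\<delta>' < 1"
    and "\<And>n a b. n \<ge> 1 \<Longrightarrow> a < p n \<Longrightarrow> b < p n \<Longrightarrow> b \<noteq> a \<Longrightarrow>
           b \<notin> neighborhood (M n) (p n) (X n) a \<Longrightarrow>
           \<bar>nbhd_stability (M n) (p n) (X n) a b\<bar> < \<delta>'"
    and "0 < \<alpha>" and "\<alpha> < 1"
    and "\<And>n a \<omega>. n \<ge> 1 \<Longrightarrow> a < p n \<Longrightarrow> \<omega> \<in> space (M n) \<Longrightarrow>
           is_lasso n (p n) (\<lambda>i k. obs n i k \<omega>) a
             (penalty n (p n) (\<lambda>i k. obs n i k \<omega>) \<alpha> a) (\<theta>hat n a \<omega>)"
    and "R \<in> {(\<and>), (\<or>)}"
  shows "\<forall>n\<ge>1. outer_measure_of (M n)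
           {\<omega> \<in> space (M n). \<exists>a<p n.
              \<not> component (est_edges R (p n) (\<lambda>a. \<theta>hat n a \<omega>)) a
                \<subseteq> component (edges (M n) (p n) (X n)) a}
         \<le> ennreal \<alpha>"
proof (intro allI impI)
  fix n :: nat
  assume n: "1 \<le> n"
  show "outer_measure_of (M n)
           {\<omega> \<in> space (M n). \<exists>a<p n.
              \<not> component (est_edges R (p n) (\<lambda>a. \<theta>hat n a \<omega>)) a
                \<subseteq> component (edges (M n) (p n) (X n)) a}
         \<le> ennreal \<alpha>"
  proof (rule component_error_bound[where M = "M n" and X = "X n" and obs = "obs n" and n = n])
    show "x \<or> y" if "R x y" for x y using \<open>R \<in> {(\<and>), (\<or>)}\<close> that by auto
  qed (use assms n in auto)
qed

end
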